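(* Let $\rho\ge1$ and let $\mathcal{A}$ be a polynomial time $\rho$-violating algorithm for the $\mathscr{F}$-PCM problem. Then there is a polynomial time $3$-approximate-$\rho$-violating algorithm for the Robust $\mathscr{F}$-Supplier problem.
   Context: Robust $\mathscr{F}$-Supplier problem: input $\mathscr{I}=(F,C,d,m,\mathscr{F})$ with $X=F\cup C$ finite, $d$ a metric on $X$, $\mathscr{F}\subseteq2^F$ down-closed, and $m\in\{0,\dots,|C|\}$; with $d(v,S)=\min_{u\in S}d(v,u)$, the goal is to find $S\in\mathscr{F}$ and $T\subseteq C$ with $|T|\ge m$ minimizing $\max_{u\in T}d(u,S)$, with optimum $\mathsf{opt}(\mathscr{I})$. $\mathscr{F}$-PCM problem: input $\mathscr{J}=(F,\mathscr{F},\mathscr{P},\mathsf{val})$ with $\mathscr{P}$ a sub-partition of $F$ and $\mathsf{val}:F\to\{0,1,2,\dots\}$ poly-bounded and constant on each part of $\mathscr{P}$; $\mathsf{opt}(\mathscr{J})=\max\{\mathsf{val}(S):S\in\mathscr{F},|S\cap A|\le1\ \forall A\in\mathscr{P}\}$, $\mathsf{val}(S)=\sum_{f\in S}\mathsf{val}(f)$. Relaxations: for each $\beta\ge1$ a family $\mathscr{F}^R_\beta\supseteq\mathscr{F}$ of subsets of $F$ is designated as the $\beta$-relaxation of $\mathscr{F}$ (e.g. for knapsack constraints $w_i(S)\le k_i$, the sets with $w_i(S)\le\beta k_i$). A $\rho$-violating algorithm for $\mathscr{F}$-PCM returns $S\in\mathscr{F}^R_\rho$ with $|S\cap A|\le1$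 for all $A\in\mathscr{P}$ and $\mathsf{val}(S)\ge\mathsf{opt}(\mathscr{J})$. An $\alpha$-approximate $\beta$-violating algorithm for Robust $\mathscr{F}$-Supplier returns $S\in\mathscr{F}^R_\beta$ such that at least $m$ customers $v\in C$ satisfy $d(v,S)\le\alpha\,\mathsf{opt}(\mathscr{I})$. *)

theory Defs
  imports
    "HOL-Analysis.Analysis"
    "HOL-Computational_Algebra.Polynomial"
    "HOL-Library.Log_Nat"
    "HOL-Library.Disjoint_Sets"
begin

section \<open>Model of computation\<close>

text \<open>
  Algorithms are programs of a register language whose data are binary trees with natural
  numbers at the leaves. Numbers are measured in binary, and evaluating an expression costs the
  size of the value computed at each of its nodes. All operators are polynomial time computable
  on bit strings and every value that is formed is paid for in full, so, up to a polynomial, the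
  cost agrees with the number of steps of a Turing machine.
\<close>

datatype data = Leaf nat | Node data data

fun dsize :: "data \<Rightarrow> nat" where
  "dsize (Leaf n) = 1 + floorlog 2 n"
| "dsize (Node a b) = 1 + dsize a + dsize b"

datatype exp =
    Reg nat
  | Const data
  | Mk exp exp
  | Lft exp
  | Rgt exp
  | IsNode exp
  | Eq exp exp
  | Less exp exp
  | Plus exp exp
  | Minus exp exp
  | Times exp exp

type_synonym regs = "nat \<Rightarrow> data"

fun num_of :: "data \<Rightarrow> nat" where
  "num_of (Leaf n) = n"
| "num_of (Node a b) = 0"

fun left :: "data \<Rightarrow> data" where
  "left (Leaf n) = Leaf 0"
| "left (Node a b) = a"

fun right :: "data \<Rightarrow> data" where
  "right (Leaf n) = Leaf 0"
| "right (Node a b) = b"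

definition truth :: "bool \<Rightarrow> data" where
  "truth b = Leaf (if b then 1 else 0)"

text \<open>\<open>Minus\<close> is truncated subtraction; the arithmetic operators read a non-leaf as \<open>0\<close>.\<close>

fun eval :: "exp \<Rightarrow> regs \<Rightarrow> data" where
  "eval (Reg x) s = s x"
| "eval (Const c) s = c"
| "eval (Mk e f) s = Node (eval e s) (eval f s)"
| "eval (Lft e) s = left (eval e s)"
| "eval (Rgt e) s = right (eval e s)"
| "eval (IsNode e) s = truth (\<exists>a b. eval e s = Node a b)"
| "eval (Eq e f) s = truth (eval e s = eval f s)"
| "eval (Less e f) s = truth (num_of (eval e s) < num_of (eval f s))"
| "eval (Plus e f) s = Leaf (num_of (eval e s) + num_of (eval f s))"
| "eval (Minus e f) s = Leaf (num_of (eval e s) - num_of (eval f s))"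
| "eval (Times e f) s = Leaf (num_of (eval e s) * num_of (eval f s))"

fun ecost :: "exp \<Rightarrow> regs \<Rightarrow> nat" where
  "ecost (Reg x) s = dsize (s x)"
| "ecost (Const c) s = dsize c"
| "ecost (Mk e f) s = ecost e s + ecost f s + dsize (eval (Mk e f) s)"
| "ecost (Lft e) s = ecost e s + dsize (eval (Lft e) s)"
| "ecost (Rgt e) s = ecost e s + dsize (eval (Rgt e) s)"
| "ecost (IsNode e) s = ecost e s + dsize (eval (IsNode e) s)"
| "ecost (Eq e f) s = ecost e s + ecost f s + dsize (eval (Eq e f) s)"
| "ecost (Less e f) s = ecost e s + ecost f s + dsize (eval (Less e f) s)"
| "ecost (Plus e f) s = ecost e s + ecost f s + dsize (eval (Plus e f) s)"
| "ecost (Minus e f) s = ecost e s + ecost f s + dsize (eval (Minus e f) s)"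
| "ecost (Times e f) s = ecost e s + ecost f s + dsize (eval (Times e f) s)"

text \<open>
  \<open>Call x c e\<close> runs \<open>c\<close> on the value of \<open>e\<close> in a fresh set of registers and stores its output
  in register \<open>x\<close>. Register \<open>0\<close> is both the input and the output register of a program. The
  value \<open>Leaf 0\<close> counts as false, any other value as true.
\<close>

datatype com =
    Assign nat exp
  | Seq com com
  | If exp com com
  | While exp com
  | Call nat com exp

definition start :: "data \<Rightarrow> regs" where
  "start v = (\<lambda>_. Leaf 0)(0 := v)"

inductive exec :: "com \<Rightarrow> regs \<Rightarrow> nat \<Rightarrow> regs \<Rightarrow> bool" where
  Assign: "exec (Assign x e) s (ecost e s) (s(x := eval e s))"
| Seq: "exec c s t s' \<Longrightarrow> exec c' s' t' s'' \<Longrightarrow> exec (Seq c c') s (t + t') s''"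
| IfTrue: "eval e s \<noteq> Leaf 0 \<Longrightarrow> exec c s t s' \<Longrightarrow> exec (If e c c') s (ecost e s + t) s'"
| IfFalse: "eval e s = Leaf 0 \<Longrightarrow> exec c' s t s' \<Longrightarrow> exec (If e c c') s (ecost e s + t) s'"
| WhileFalse: "eval e s = Leaf 0 \<Longrightarrow> exec (While e c) s (ecost e s) s"
| WhileTrue: "eval e s \<noteq> Leaf 0 \<Longrightarrow> exec c s t s' \<Longrightarrow> exec (While e c) s' t' s'' \<Longrightarrow>
    exec (While e c) s (ecost e s + t + t') s''"
| Call: "exec c (start (eval e s)) t s' \<Longrightarrow>
    exec (Call x c e) s (ecost e s + t + dsize (s' 0)) (s(x := s' 0))"

inductive_cases AssignE: "exec (Assign x e) s t s'"
inductive_cases SeqE: "exec (Seq c c') s t s'"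
inductive_cases IfE: "exec (If e c c') s t s'"
inductive_cases WhileE: "exec (While e c) s t s'"
inductive_cases CallE: "exec (Call x c e) s t s'"

lemma exec_deterministic:
  "exec c s t s' \<Longrightarrow> exec c s u s'' \<Longrightarrow> t = u \<and> s' = s''"
proof (induction arbitrary: u s'' rule: exec.induct)
  case (Assign x e s)
  then show ?case by (auto elim: AssignE)
next
  case (Seq c s t s' c' t' r)
  from Seq.prems show ?case by (rule SeqE) (use Seq.IH in blast)
next
  case (IfTrue e s c t s' c')
  from IfTrue.prems show ?case by (rule IfE) (use IfTrue in blast)+
next
  case (IfFalse e s c' t s' c)
  from IfFalse.prems show ?case by (rule IfE) (use IfFalse in blast)+
next
  case (WhileFalse e s c)
  from WhileFalse.prems show ?case by (rule WhileE) (use WhileFalse in blast)+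
next
  case (WhileTrue e s c t s' t' r)
  from WhileTrue.prems show ?case by (rule WhileE) (use WhileTrue in blast)+
next
  case (Call c e s t s' x)
  from Call.prems show ?case by (rule CallE) (use Call.IH in blast)
qed

definition runs :: "com \<Rightarrow> data \<Rightarrow> nat \<Rightarrow> data \<Rightarrow> bool" where
  "runs c v t w \<longleftrightarrow> (\<exists>s. exec c (start v) t s \<and> s 0 = w)"

definition polynomial_time :: "com \<Rightarrow> data set \<Rightarrow> bool" where
  "polynomial_time c V \<longleftrightarrow>
     (\<exists>p :: nat poly. \<forall>v\<in>V. \<exists>t w. runs c v t w \<and> t \<le> poly p (dsize v))"

definition returns :: "com \<Rightarrow> data \<Rightarrow> data \<Rightarrow> bool" where
  "returns c v w \<longleftrightarrow> (\<exists>t. runs c v t w)"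


section \<open>The two optimization problems\<close>

definition down_closed :: "nat set \<Rightarrow> nat set set \<Rightarrow> bool" where
  "down_closed F \<F> \<longleftrightarrow> \<F> \<subseteq> Pow F \<and> (\<forall>S\<in>\<F>. \<forall>T. T \<subseteq> S \<longrightarrow> T \<in> \<F>)"

definition supplier_instance ::
  "nat set \<Rightarrow> nat set \<Rightarrow> (nat \<Rightarrow> nat \<Rightarrow> real) \<Rightarrow> nat \<Rightarrow> nat set set \<Rightarrow> bool" where
  "supplier_instance F C d m \<F> \<longleftrightarrow>
     finite F \<and> finite C \<and> Metric_space (F \<union> C) d \<and> m \<le> card C \<and> down_closed F \<F>"

text \<open>
  Distances are taken in the extended nonnegative reals: the distance to the empty set is
  \<open>\<infinity>\<close>, the maximum over the empty set is \<open>0\<close>, and the optimum of an instance without a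
  solution is \<open>\<infinity>\<close>. All index sets are finite, so the infima and suprema are otherwise
  attained.
\<close>

definition dist_to :: "(nat \<Rightarrow> nat \<Rightarrow> real) \<Rightarrow> nat \<Rightarrow> nat set \<Rightarrow> ennreal" where
  "dist_to d v S = (INF u\<in>S. ennreal (d v u))"

definition supplier_opt ::
  "nat set \<Rightarrow> (nat \<Rightarrow> nat \<Rightarrow> real) \<Rightarrow> nat \<Rightarrow> nat set set \<Rightarrow> ennreal" where
  "supplier_opt C d m \<F> =
     (INF (S, T) \<in> {(S, T). S \<in> \<F> \<and> T \<subseteq> C \<and> m \<le> card T}. SUP u\<in>T. dist_to d u S)"

definition pcm_instance ::
  "nat set \<Rightarrow> nat set set \<Rightarrow> nat set set \<Rightarrow> (nat \<Rightarrow> nat) \<Rightarrow> bool" where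
  "pcm_instance F \<F> P val \<longleftrightarrow>
     finite F \<and> down_closed F \<F> \<and> \<Union>P \<subseteq> F \<and> partition_on (\<Union>P) P \<and>
     (\<forall>A\<in>P. \<forall>f\<in>A. \<forall>g\<in>A. val f = val g)"

definition pcm_opt :: "nat set set \<Rightarrow> nat set set \<Rightarrow> (nat \<Rightarrow> nat) \<Rightarrow> nat" where
  "pcm_opt \<F> P val = Max {sum val S | S. S \<in> \<F> \<and> (\<forall>A\<in>P. card (S \<inter> A) \<le> 1)}"


section \<open>Families given by descriptions\<close>

text \<open>
  As part of the input of an algorithm, the family \<open>\<F>\<close> is given by a description (for
  knapsack constraints: the weights and the capacities). A family class fixes which data
  describe a family over the ground set \<open>F\<close>, the family described, and its
  \<open>\<beta>\<close>-relaxations.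
\<close>

record family_class =
  descriptions :: "nat set \<Rightarrow> data set"
  family :: "nat set \<Rightarrow> data \<Rightarrow> nat set set"
  relaxation :: "real \<Rightarrow> nat set \<Rightarrow> data \<Rightarrow> nat set set"

definition valid_class :: "family_class \<Rightarrow> bool" where
  "valid_class K \<longleftrightarrow>
     (\<forall>F \<delta>. finite F \<longrightarrow> \<delta> \<in> descriptions K F \<longrightarrow>
        down_closed F (family K F \<delta>) \<and>
        (\<forall>\<beta>\<ge>1. family K F \<delta> \<subseteq> relaxation K \<beta> F \<delta> \<and> relaxation K \<beta> F \<delta> \<subseteq> Pow F))"


section \<open>Encodings\<close>

definition list_code :: "data list \<Rightarrow> data" where
  "list_code vs = foldr Node vs (Leaf 0)"

definition nats_code :: "nat list \<Rightarrow> data" where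
  "nats_code xs = list_code (map Leaf xs)"

definition enumerates :: "nat list \<Rightarrow> nat set \<Rightarrow> bool" where
  "enumerates xs S \<longleftrightarrow> distinct xs \<and> set xs = S"

definition set_code :: "nat set \<Rightarrow> data \<Rightarrow> bool" where
  "set_code S v \<longleftrightarrow> (\<exists>xs. enumerates xs S \<and> v = nats_code xs)"

definition sets_code :: "nat set set \<Rightarrow> data \<Rightarrow> bool" where
  "sets_code P v \<longleftrightarrow>
     (\<exists>xss. (\<forall>xs\<in>set xss. distinct xs) \<and> distinct (map set xss) \<and> set (map set xss) = P \<and>
       v = list_code (map nats_code xss))"

text \<open>
  An input metric is rational; it is given by the list of all \<open>(x, y, a, b)\<close> with
  \<open>d x y = a / b\<close> and \<open>a\<close>, \<open>b\<close> in binary.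
\<close>

definition metric_code :: "nat set \<Rightarrow> (nat \<Rightarrow> nat \<Rightarrow> real) \<Rightarrow> data \<Rightarrow> bool" where
  "metric_code X d v \<longleftrightarrow>
     (\<exists>xs a b. enumerates xs X \<and>
       (\<forall>x\<in>X. \<forall>y\<in>X. 0 < b x y \<and> d x y = real (a x y) / real (b x y)) \<and>
       v = list_code [nats_code [x, y, a x y, b x y]. x \<leftarrow> xs, y \<leftarrow> xs])"

text \<open>
  The values of an \<open>\<F>\<close>-PCM instance are polynomially bounded, i.e. the running time is
  measured with these numbers written in unary.
\<close>

definition unary :: "nat \<Rightarrow> data" where
  "unary n = list_code (replicate n (Leaf 0))"

definition values_code :: "nat set \<Rightarrow> (nat \<Rightarrow> nat) \<Rightarrow> data \<Rightarrow> bool" where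
  "values_code F val v \<longleftrightarrow>
     (\<exists>xs. enumerates xs F \<and> v = list_code (map (\<lambda>x. Node (Leaf x) (unary (val x))) xs))"

definition supplier_code ::
  "family_class \<Rightarrow> nat set \<Rightarrow> nat set \<Rightarrow> (nat \<Rightarrow> nat \<Rightarrow> real) \<Rightarrow> nat \<Rightarrow> data \<Rightarrow> data \<Rightarrow> bool" where
  "supplier_code K F C d m \<delta> v \<longleftrightarrow>
     \<delta> \<in> descriptions K F \<and> supplier_instance F C d m (family K F \<delta>) \<and>
     (\<exists>f c e. set_code F f \<and> set_code C c \<and> metric_code (F \<union> C) d e \<and>
       v = list_code [f, c, e, Leaf m, \<delta>])"

definition pcm_code ::
  "family_class \<Rightarrow> nat set \<Rightarrow> data \<Rightarrow> nat set set \<Rightarrow> (nat \<Rightarrow> nat) \<Rightarrow> data \<Rightarrow> bool" where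
  "pcm_code K F \<delta> P val v \<longleftrightarrow>
     \<delta> \<in> descriptions K F \<and> pcm_instance F (family K F \<delta>) P val \<and>
     (\<exists>f p w. set_code F f \<and> sets_code P p \<and> values_code F val w \<and>
       v = list_code [f, \<delta>, p, w])"

definition supplier_inputs :: "family_class \<Rightarrow> data set" where
  "supplier_inputs K = {v. \<exists>F C d m \<delta>. supplier_code K F C d m \<delta> v}"

definition pcm_inputs :: "family_class \<Rightarrow> data set" where
  "pcm_inputs K = {v. \<exists>F \<delta> P val. pcm_code K F \<delta> P val v}"


section \<open>Approximation guarantees\<close>

definition violating_pcm_algorithm :: "family_class \<Rightarrow> real \<Rightarrow> com \<Rightarrow> bool" where
  "violating_pcm_algorithm K \<rho> c \<longleftrightarrow>
     (\<forall>F \<delta> P val v. pcm_code K F \<delta> P val v \<longrightarrow>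
       (\<exists>w S. returns c v w \<and> set_code S w \<and>
         S \<in> relaxation K \<rho> F \<delta> \<and> (\<forall>A\<in>P. card (S \<inter> A) \<le> 1) \<and>
         pcm_opt (family K F \<delta>) P val \<le> sum val S))"

definition approx_violating_supplier_algorithm ::
  "family_class \<Rightarrow> real \<Rightarrow> real \<Rightarrow> com \<Rightarrow> bool" where
  "approx_violating_supplier_algorithm K \<alpha> \<beta> c \<longleftrightarrow>
     (\<forall>F C d m \<delta> v. supplier_code K F C d m \<delta> v \<longrightarrow>
       (\<exists>w S. returns c v w \<and> set_code S w \<and>
         S \<in> relaxation K \<beta> F \<delta> \<and>
         m \<le> card {u\<in>C. dist_to d u S \<le> ennreal \<alpha> * supplier_opt C d m (family K F \<delta>)}))"

end

theory Submission
  imports Defs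
begin

text \<open>
  Fix a radius \<open>r\<close>. Given loads \<open>L v \<ge> 0\<close> on the customers, go through the customers by
  increasing load and keep as heads those at distance more than \<open>2 r\<close> from all earlier heads;
  every customer \<open>q\<close> then has a head \<open>h q\<close> within \<open>2 r\<close> with \<open>L (h q) \<le> L q\<close>. The balls of radius
  \<open>r\<close> around the heads are disjoint parts of a PCM instance in which a facility is worth the
  number of customers whose head is within \<open>r\<close> of it. A solution of value at least \<open>m\<close> serves \<open>m\<close>
  customers within \<open>3 r\<close>. Otherwise, for every \<open>T\<close> covered by a feasible set within \<open>r\<close>, fewer
  than \<open>m\<close> customers have their head in \<open>T\<close>.

  The paper separates a point from a polytope in this way and runs the ellipsoid method. A
  perceptron suffices: let each customer add one unit of load to its head and repeat. If all
  rounds fail, the loads on an optimal \<open>T\<close> fall behind the average by one per round, while the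
  variance of the loads grows too slowly for this to last more than \<open>(card C)\<^sup>3\<close> rounds. So
  \<open>(card C)\<^sup>3 + 1\<close> rounds at every radius occurring as a distance, followed by the choice of
  the successful solution of smallest radius, yield the algorithm.

  Its running time is bounded compositionally, by closing the polynomial time functions on
  encoded types under the list operations from which the algorithm is built.
\<close>

section \<open>Polynomial time functions\<close>

definition polyf :: "(nat \<Rightarrow> nat) \<Rightarrow> bool" where
  "polyf b \<longleftrightarrow> (\<exists>p. b = poly p)"

named_theorems polyf_intros

lemma polyf_const [polyf_intros]: "polyf (\<lambda>_. k)"
  unfolding polyf_def by (rule exI[of _ "[:k:]"]) auto

lemma polyf_id [polyf_intros]: "polyf (\<lambda>n. n)"
  unfolding polyf_def by (rule exI[of _ "[:0, 1:]"]) auto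

lemma polyf_add [polyf_intros]: "polyf f \<Longrightarrow> polyf g \<Longrightarrow> polyf (\<lambda>n. f n + g n)"
  unfolding polyf_def by (force simp: poly_add[symmetric] simp del: poly_add)

lemma polyf_mult [polyf_intros]: "polyf f \<Longrightarrow> polyf g \<Longrightarrow> polyf (\<lambda>n. f n * g n)"
  unfolding polyf_def by (force simp: poly_mult[symmetric] simp del: poly_mult)

lemma polyf_Suc [polyf_intros]: "polyf f \<Longrightarrow> polyf (\<lambda>n. Suc (f n))"
  using polyf_add[OF _ polyf_const, of f 1] by simp

lemma polyf_power [polyf_intros]: "polyf f \<Longrightarrow> polyf (\<lambda>n. f n ^ k)"
  unfolding polyf_def by (force simp: poly_power[symmetric] simp del: poly_power)

lemma polyf_comp: "polyf f \<Longrightarrow> polyf g \<Longrightarrow> polyf (\<lambda>n. f (g n))"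
  unfolding polyf_def by (force simp: poly_pcompose[symmetric] simp del: poly_pcompose)

text \<open>The coefficients are natural numbers, hence nonnegative. Monotonicity is what allows a
  bound on an intermediate size to be inserted into the time bound of the next program.\<close>

lemma polyf_mono:
  assumes "polyf f" "m \<le> n"
  shows "f m \<le> f n"
proof -
  obtain p where f: "f = poly p" using assms(1) polyf_def by blast
  have "poly p m \<le> poly p n"
    by (induction p) (auto intro!: mult_mono add_mono assms(2))
  then show ?thesis by (simp add: f)
qed

lemma dsize_eval_le_ecost: "dsize (eval e s) \<le> ecost e s"
  by (cases e) auto

text \<open>Every value that is written has been paid for in full. The maximum accounts for
  registers that keep their initial value.\<close>

lemma exec_dsize_le: "exec c s t s' \<Longrightarrow> dsize (s' x) \<le> max (dsize (s x)) t"
proof (induction rule: exec.induct)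
  case (Assign y e s)
  then show ?case using dsize_eval_le_ecost[of e s] by auto
qed (auto simp: max_def split: if_splits)

section \<open>Injective encodings of types as data\<close>

class enc =
  fixes enc :: "'a \<Rightarrow> data"
  assumes enc_inject: "enc x = enc y \<Longrightarrow> x = y"

abbreviation esize :: "'a::enc \<Rightarrow> nat" where
  "esize x \<equiv> dsize (enc x)"

instantiation data :: enc
begin
definition enc_data :: "data \<Rightarrow> data" where "enc v = v"
instance by standard (simp add: enc_data_def)
end

instantiation nat :: enc
begin
definition enc_nat :: "nat \<Rightarrow> data" where "enc n = Leaf n"
instance by standard (simp add: enc_nat_def)
end

instantiation bool :: enc
begin
definition enc_bool :: "bool \<Rightarrow> data" where "enc b = truth b"
instance by standard (simp add: enc_bool_def truth_def split: if_splits)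
end

instantiation prod :: (enc, enc) enc
begin
fun enc_prod :: "'a \<times> 'b \<Rightarrow> data" where "enc (x, y) = Node (enc x) (enc y)"
instance by standard (auto dest: enc_inject)
end

text \<open>The choice of \<open>list_code\<close> makes typed lists agree literally with the
  encodings in the problem definitions. A list of fixed length with entries of different types
  becomes a nested tuple whose last component \<open>0\<close> is the end marker.\<close>

instantiation list :: (enc) enc
begin
definition enc_list :: "'a list \<Rightarrow> data" where "enc xs = list_code (map enc xs)"
instance
proof
  show "xs = ys" if "enc xs = enc ys" for xs ys :: "'a list"
    using that
  proof (induction xs arbitrary: ys)
    case Nil
    then show ?case by (cases ys) (auto simp: enc_list_def list_code_def)
  next
    case (Cons x xs)
    then show ?case by (cases ys) (auto simp: enc_list_def list_code_def dest: enc_inject)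
  qed
qed
end

lemma enc_Nil [simp]: "enc [] = Leaf 0"
  and enc_Cons [simp]: "enc (x # xs) = Node (enc x) (enc xs)"
  by (auto simp: enc_list_def list_code_def)

lemma enc_list_Node: "enc xs = Node a b \<Longrightarrow> \<exists>y ys. xs = y # ys"
  by (cases xs) auto

lemma esize_list: "esize xs = 1 + (\<Sum>x\<leftarrow>xs. 1 + esize x)"
  by (induction xs) (auto simp: floorlog_def)

lemma length_le_esize: "length xs < esize xs"
  by (induction xs) (auto simp: floorlog_def)

lemma member_esize: "x \<in> set xs \<Longrightarrow> esize x < esize xs"
  by (induction xs) auto

lemma esize_list_le:
  assumes "\<And>x. x \<in> set xs \<Longrightarrow> esize x \<le> B" "length xs \<le> n"
  shows "esize xs \<le> 1 + n * (1 + B)"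
proof -
  have "(\<Sum>x\<leftarrow>xs. 1 + esize x) \<le> (\<Sum>x\<leftarrow>xs. 1 + B)"
    by (intro sum_list_mono) (auto simp: assms(1))
  also have "\<dots> = length xs * (1 + B)" by (simp add: sum_list_triv)
  also have "\<dots> \<le> n * (1 + B)" using assms(2) by (intro mult_right_mono) auto
  finally show ?thesis by (simp add: esize_list)
qed

lemma floorlog_le: "floorlog 2 n \<le> n"
proof -
  have "n < 2 ^ n" by (simp add: less_exp)
  then show ?thesis by (simp add: floorlog_le_iff)
qed

lemma esize_nat_le: "esize (n::nat) \<le> 1 + n"
  using floorlog_le by (simp add: enc_nat_def)

text \<open>The domain \<open>V\<close> is essential: the given PCM algorithm is promised to halt
  only on codes of PCM instances, so its time bound cannot be stated for all inputs.\<close>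

definition ptime :: "'a::enc set \<Rightarrow> ('a \<Rightarrow> 'b::enc) \<Rightarrow> bool" where
  "ptime V f \<longleftrightarrow>
     (\<exists>c b. polyf b \<and> (\<forall>x\<in>V. \<exists>t. runs c (enc x) t (enc (f x)) \<and> t \<le> b (esize x)))"

lemma ptimeI:
  assumes "polyf b"
    and "\<And>x. x \<in> V \<Longrightarrow> \<exists>t s. exec c (start (enc x)) t s \<and> s 0 = enc (f x) \<and> t \<le> b (esize x)"
  shows "ptime V f"
  unfolding ptime_def runs_def using assms by blast

lemma ptimeE:
  assumes "ptime V f"
  obtains c b where "polyf b"
    and "\<And>x. x \<in> V \<Longrightarrow>
      \<exists>t. runs c (enc x) t (enc (f x)) \<and> t \<le> b (esize x) \<and> esize (f x) \<le> b (esize x)"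
proof -
  obtain c b where b: "polyf b"
    and c: "\<And>x. x \<in> V \<Longrightarrow> \<exists>t. runs c (enc x) t (enc (f x)) \<and> t \<le> b (esize x)"
    using assms unfolding ptime_def by blast
  show thesis
  \<comment> \<open>Register \<open>0\<close> starts with the input, so the output is no larger than
    the input or the running time; the sum covers both cases.\<close>
  proof (rule that[of "\<lambda>n. n + b n" c])
    show "polyf (\<lambda>n. n + b n)" by (intro polyf_intros b)
    fix x assume "x \<in> V"
    then obtain t s where t: "exec c (start (enc x)) t s" "s 0 = enc (f x)" "t \<le> b (esize x)"
      using c[of x] unfolding runs_def by blast
    have "dsize (s 0) \<le> max (dsize (start (enc x) 0)) t" by (rule exec_dsize_le[OF t(1)])
    then have "esize (f x) \<le> esize x + b (esize x)"
      using t(2,3) by (auto simp: start_def)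
    then show "\<exists>t. runs c (enc x) t (enc (f x)) \<and> t \<le> esize x + b (esize x) \<and>
        esize (f x) \<le> esize x + b (esize x)"
      using t unfolding runs_def by (intro exI[of _ t]) auto
  qed
qed

lemma exec_Call:
  assumes "runs c (eval e s) t w"
  shows "exec (Call x c e) s (ecost e s + t + dsize w) (s(x := w))"
  using assms exec.Call unfolding runs_def by blast

lemma exec_Assign:
  "w = eval e s \<Longrightarrow> exec (Assign x e) s (ecost e s) (s(x := w))"
  using exec.Assign by simp

lemma exec_result:
  "exec c s t s' \<Longrightarrow> s' 0 = w \<Longrightarrow> t \<le> b \<Longrightarrow> \<exists>t s'. exec c s t s' \<and> s' 0 = w \<and> t \<le> b"
  by blast

lemma ptime_mono: "ptime W f \<Longrightarrow> V \<subseteq> W \<Longrightarrow> ptime V f"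
  unfolding ptime_def by blast

lemma ptime_cong: "(\<And>x. x \<in> V \<Longrightarrow> f x = g x) \<Longrightarrow> ptime V f \<longleftrightarrow> ptime V g"
  unfolding ptime_def by simp

text \<open>The second time bound is evaluated at the bound on the output size of the first program,
  which \<open>ptimeE\<close> supplies, and polynomials are closed under composition.\<close>

lemma ptime_compose:
  assumes g: "ptime W g" and f: "ptime V f" and dom: "\<And>x. x \<in> V \<Longrightarrow> f x \<in> W"
  shows "ptime V (\<lambda>x. g (f x))"
proof -
  obtain c1 b1 where b1: "polyf b1"
    and c1: "\<And>x. x \<in> V \<Longrightarrow>
      \<exists>t. runs c1 (enc x) t (enc (f x)) \<and> t \<le> b1 (esize x) \<and> esize (f x) \<le> b1 (esize x)"
    using f by (rule ptimeE) blast
  obtain c2 b2 where b2: "polyf b2"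
    and c2: "\<And>x. x \<in> W \<Longrightarrow>
      \<exists>t. runs c2 (enc x) t (enc (g x)) \<and> t \<le> b2 (esize x) \<and> esize (g x) \<le> b2 (esize x)"
    using g by (rule ptimeE) blast
  let ?b = "\<lambda>n. n + b1 n + b1 n + (b1 n + b2 (b1 n) + b2 (b1 n))"
  show ?thesis
  proof (rule ptimeI[of ?b _ "Seq (Call 0 c1 (Reg 0)) (Call 0 c2 (Reg 0))"])
    show "polyf ?b" by (intro polyf_intros polyf_comp[OF b2] b1)
    fix x assume x: "x \<in> V"
    define s where "s = start (enc x)"
    have s0: "s 0 = enc x" by (simp add: s_def start_def)
    obtain t1 where t1: "runs c1 (enc x) t1 (enc (f x))" "t1 \<le> b1 (esize x)"
      "esize (f x) \<le> b1 (esize x)" using c1[OF x] by blast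
    obtain t2 where t2: "runs c2 (enc (f x)) t2 (enc (g (f x)))" "t2 \<le> b2 (esize (f x))"
      "esize (g (f x)) \<le> b2 (esize (f x))" using c2[OF dom[OF x]] by blast
    have "b2 (esize (f x)) \<le> b2 (b1 (esize x))" by (rule polyf_mono[OF b2 t1(3)])
    moreover have ex: "exec (Seq (Call 0 c1 (Reg 0)) (Call 0 c2 (Reg 0))) s
      ((esize x + t1 + esize (f x)) + (esize (f x) + t2 + esize (g (f x))))
      (s(0 := enc (f x), 0 := enc (g (f x))))"
      using exec_Call[of c1 "Reg 0" s t1 "enc (f x)" 0]
        exec_Call[of c2 "Reg 0" "s(0 := enc (f x))" t2 "enc (g (f x))" 0] t1 t2 s0
      by (intro exec.Seq) auto
    ultimately show "\<exists>t s. exec (Seq (Call 0 c1 (Reg 0)) (Call 0 c2 (Reg 0))) (start (enc x)) t s \<and>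
        s 0 = enc (g (f x)) \<and> t \<le> ?b (esize x)"
      unfolding s_def[symmetric] by (intro exec_result[OF ex]) (use t1 t2 in auto)
  qed
qed

section \<open>Basic operations: pairs, lists, numbers and branching\<close>

named_theorems ptime_intros

lemma ptime_const [ptime_intros]: "ptime V (\<lambda>_. k)"
proof (rule ptimeI[of "\<lambda>_. esize k" _ "Assign 0 (Const (enc k))"])
  show "polyf (\<lambda>_. esize k)" by (intro polyf_intros)
  fix x :: 'a
  show "\<exists>t s. exec (Assign 0 (Const (enc k))) (start (enc x)) t s \<and> s 0 = enc k \<and> t \<le> esize k"
    using exec.Assign[of 0 "Const (enc k)" "start (enc x)"] by (intro exI conjI, assumption) auto
qed

lemma ptime_id [ptime_intros]: "ptime V (\<lambda>x. x)"
proof (rule ptimeI[of "\<lambda>n. n" _ "Assign 0 (Reg 0)"])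
  show "polyf (\<lambda>n. n)" by (intro polyf_intros)
  fix x :: 'a
  show "\<exists>t s. exec (Assign 0 (Reg 0)) (start (enc x)) t s \<and> s 0 = enc x \<and> t \<le> esize x"
    using exec.Assign[of 0 "Reg 0" "start (enc x)"]
    by (intro exI conjI, assumption) (auto simp: start_def)
qed

text \<open>Reduces an operation to one expression \<open>e\<close> over registers \<open>1\<close>
  and \<open>2\<close>. Since \<open>Call\<close> uses fresh registers, the input survives in
  register \<open>0\<close> until both arguments have been computed.\<close>

lemma ptime_binary:
  assumes f: "ptime V f" and g: "ptime V g" and q: "polyf q"
    and e: "\<And>s u w. s 1 = enc u \<Longrightarrow> s 2 = enc w \<Longrightarrow>
      eval e s = enc (h u w) \<and> ecost e s \<le> q (esize u + esize w)"
  shows "ptime V (\<lambda>x. h (f x) (g x))"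
proof -
  obtain c1 b1 where b1: "polyf b1"
    and c1: "\<And>x. x \<in> V \<Longrightarrow>
      \<exists>t. runs c1 (enc x) t (enc (f x)) \<and> t \<le> b1 (esize x) \<and> esize (f x) \<le> b1 (esize x)"
    using f by (rule ptimeE) blast
  obtain c2 b2 where b2: "polyf b2"
    and c2: "\<And>x. x \<in> V \<Longrightarrow>
      \<exists>t. runs c2 (enc x) t (enc (g x)) \<and> t \<le> b2 (esize x) \<and> esize (g x) \<le> b2 (esize x)"
    using g by (rule ptimeE) blast
  let ?b = "\<lambda>n. n + b1 n + b1 n + ((n + b2 n + b2 n) + q (b1 n + b2 n))"
  let ?c = "Seq (Call 1 c1 (Reg 0)) (Seq (Call 2 c2 (Reg 0)) (Assign 0 e))"
  show ?thesis
  proof (rule ptimeI[of ?b _ ?c])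
    show "polyf ?b" by (intro polyf_intros polyf_comp[OF q] b1 b2)
    fix x assume x: "x \<in> V"
    define s where "s = start (enc x)"
    have s0: "s 0 = enc x" by (simp add: s_def start_def)
    obtain t1 where t1: "runs c1 (enc x) t1 (enc (f x))" "t1 \<le> b1 (esize x)"
      "esize (f x) \<le> b1 (esize x)" using c1[OF x] by blast
    obtain t2 where t2: "runs c2 (enc x) t2 (enc (g x))" "t2 \<le> b2 (esize x)"
      "esize (g x) \<le> b2 (esize x)" using c2[OF x] by blast
    define s' where "s' = s(1 := enc (f x), 2 := enc (g x))"
    have e': "eval e s' = enc (h (f x) (g x))" "ecost e s' \<le> q (esize (f x) + esize (g x))"
      using e[of s' "f x" "g x"] by (auto simp: s'_def)
    have q': "q (esize (f x) + esize (g x)) \<le> q (b1 (esize x) + b2 (esize x))"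
      by (rule polyf_mono[OF q]) (use t1(3) t2(3) in simp)
    have ex: "exec ?c s ((esize x + t1 + esize (f x)) + ((esize x + t2 + esize (g x)) + ecost e s'))
        (s'(0 := enc (h (f x) (g x))))"
      using exec_Call[of c1 "Reg 0" s t1 "enc (f x)" 1]
        exec_Call[of c2 "Reg 0" "s(1 := enc (f x))" t2 "enc (g x)" 2] t1 t2 s0
        exec_Assign[OF e'(1)[symmetric], of 0]
      by (intro exec.Seq) (auto simp: s'_def)
    show "\<exists>t s. exec ?c (start (enc x)) t s \<and> s 0 = enc (h (f x) (g x)) \<and> t \<le> ?b (esize x)"
      unfolding s_def[symmetric] by (rule exec_result[OF ex]) (use t1 t2 e'(2) q' in auto)
  qed
qed

text \<open>The second argument is the dummy \<open>0\<close> of size 1, so \<open>q\<close> is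
  evaluated at one more than the size of the argument.\<close>

lemmas ptime_unary = ptime_binary[where h = "\<lambda>u _. h u" and g = "\<lambda>_. 0::nat" for h, OF _ ptime_const]

lemma ptime_Pair [ptime_intros]: "ptime V f \<Longrightarrow> ptime V g \<Longrightarrow> ptime V (\<lambda>x. (f x, g x))"
  by (rule ptime_binary[where h = Pair and e = "Mk (Reg 1) (Reg 2)" and q = "\<lambda>n. n + n + 1"])
    (auto intro!: polyf_intros)

lemma ptime_Cons [ptime_intros]: "ptime V f \<Longrightarrow> ptime V g \<Longrightarrow> ptime V (\<lambda>x. f x # g x)"
  by (rule ptime_binary[where h = Cons and e = "Mk (Reg 1) (Reg 2)" and q = "\<lambda>n. n + n + 1"])
    (auto intro!: polyf_intros)

lemma enc_prod_def: "enc z = Node (enc (fst z)) (enc (snd z))"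
  by (cases z) auto

lemma ptime_fst [ptime_intros]: "ptime V f \<Longrightarrow> ptime V (\<lambda>x. fst (f x))"
  by (rule ptime_unary[where e = "Lft (Reg 1)" and q = "\<lambda>n. n + n"])
    (auto intro!: polyf_intros simp: enc_prod_def)

lemma ptime_snd [ptime_intros]: "ptime V f \<Longrightarrow> ptime V (\<lambda>x. snd (f x))"
  by (rule ptime_unary[where e = "Rgt (Reg 1)" and q = "\<lambda>n. n + n"])
    (auto intro!: polyf_intros simp: enc_prod_def)

lemma dsize_truth: "dsize (truth b) \<le> 2"
  by (simp add: truth_def floorlog_def)

text \<open>The code of a list is a leaf exactly for the empty list, so \<open>IsNode\<close>
  decides the question.\<close>

lemma ptime_nonempty: "ptime V f \<Longrightarrow> ptime V (\<lambda>x. f x \<noteq> [])"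
  by (rule ptime_unary[where e = "IsNode (Reg 1)" and q = "\<lambda>n. n + 2" and h = "\<lambda>u. u \<noteq> []"])
    (auto intro!: polyf_intros simp: enc_bool_def truth_def floorlog_def neq_Nil_conv enc_list_Node)

lemma ptime_eq_nat [ptime_intros]:
  "ptime V f \<Longrightarrow> ptime V g \<Longrightarrow> ptime V (\<lambda>x. f x = (g x :: nat))"
  by (rule ptime_binary[where e = "Eq (Reg 1) (Reg 2)" and q = "\<lambda>n. n + 2" and h = "(=)"])
    (auto intro!: polyf_intros dsize_truth simp: enc_bool_def enc_nat_def)

lemma ptime_less_nat [ptime_intros]:
  "ptime V f \<Longrightarrow> ptime V g \<Longrightarrow> ptime V (\<lambda>x. f x < (g x :: nat))"
  by (rule ptime_binary[where e = "Less (Reg 1) (Reg 2)" and q = "\<lambda>n. n + 2"])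
    (auto intro!: polyf_intros dsize_truth simp: enc_bool_def enc_nat_def)

lemma less_power_floorlog: "n < 2 ^ floorlog 2 n"
  using floorlog_le_iff[of 2 n "floorlog 2 n"] by simp

lemma floorlog_mult_le: "floorlog 2 (m * n) \<le> floorlog 2 m + floorlog 2 n"
  using mult_strict_mono'[OF less_power_floorlog[of m] less_power_floorlog[of n]]
  by (auto simp: floorlog_le_iff power_add)

lemma floorlog_add_le: "floorlog 2 (m + n) \<le> 1 + floorlog 2 m + floorlog 2 n"
proof -
  have "m < 2 ^ (floorlog 2 m + floorlog 2 n)" "n < 2 ^ (floorlog 2 m + floorlog 2 n)"
    by (auto intro: less_le_trans[OF less_power_floorlog])
  then show ?thesis by (auto simp: floorlog_le_iff)
qed

lemma ptime_add [ptime_intros]: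
  "ptime V f \<Longrightarrow> ptime V g \<Longrightarrow> ptime V (\<lambda>x. f x + (g x :: nat))"
  by (rule ptime_binary[where e = "Plus (Reg 1) (Reg 2)" and q = "\<lambda>n. n + n"])
    (auto intro!: polyf_intros simp: enc_nat_def intro: le_trans[OF floorlog_add_le])

lemma ptime_mult [ptime_intros]:
  "ptime V f \<Longrightarrow> ptime V g \<Longrightarrow> ptime V (\<lambda>x. f x * (g x :: nat))"
  by (rule ptime_binary[where e = "Times (Reg 1) (Reg 2)" and q = "\<lambda>n. n + n"])
    (auto intro!: polyf_intros simp: enc_nat_def intro: le_trans[OF floorlog_mult_le])

lemma ptime_if [ptime_intros]:
  assumes p: "ptime V p" and f: "ptime V f" and g: "ptime V g"
  shows "ptime V (\<lambda>x. if p x then f x else g x)"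
proof -
  obtain c0 b0 where b0: "polyf b0"
    and c0: "\<And>x. x \<in> V \<Longrightarrow>
      \<exists>t. runs c0 (enc x) t (enc (p x)) \<and> t \<le> b0 (esize x) \<and> esize (p x) \<le> b0 (esize x)"
    using p by (rule ptimeE) blast
  obtain c1 b1 where b1: "polyf b1"
    and c1: "\<And>x. x \<in> V \<Longrightarrow>
      \<exists>t. runs c1 (enc x) t (enc (f x)) \<and> t \<le> b1 (esize x) \<and> esize (f x) \<le> b1 (esize x)"
    using f by (rule ptimeE) blast
  obtain c2 b2 where b2: "polyf b2"
    and c2: "\<And>x. x \<in> V \<Longrightarrow>
      \<exists>t. runs c2 (enc x) t (enc (g x)) \<and> t \<le> b2 (esize x) \<and> esize (g x) \<le> b2 (esize x)"
    using g by (rule ptimeE) blast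
  \<comment> \<open>Only one branch is executed, but adding the costs of both avoids a maximum,
    which need not be a polynomial.\<close>
  let ?b = "\<lambda>n. n + b0 n + b0 n + (b0 n + (n + b1 n + b1 n) + (n + b2 n + b2 n))"
  let ?c = "Seq (Call 1 c0 (Reg 0)) (If (Reg 1) (Call 0 c1 (Reg 0)) (Call 0 c2 (Reg 0)))"
  show ?thesis
  proof (rule ptimeI[of ?b _ ?c])
    show "polyf ?b" by (intro polyf_intros b0 b1 b2)
    fix x assume x: "x \<in> V"
    define s where "s = start (enc x)"
    have s0: "s 0 = enc x" by (simp add: s_def start_def)
    obtain t0 where t0: "runs c0 (enc x) t0 (enc (p x))" "t0 \<le> b0 (esize x)"
      "esize (p x) \<le> b0 (esize x)" using c0[OF x] by blast
    define s' where "s' = s(1 := enc (p x))"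
    have s': "s' 1 = enc (p x)" "s' 0 = enc x" by (auto simp: s'_def s0)
    have e0: "exec (Call 1 c0 (Reg 0)) s (esize x + t0 + esize (p x)) s'"
      using exec_Call[of c0 "Reg 0" s t0 "enc (p x)" 1] t0 s0 by (simp add: s'_def)
    show "\<exists>t s. exec ?c (start (enc x)) t s \<and>
        s 0 = enc (if p x then f x else g x) \<and> t \<le> ?b (esize x)"
    proof (cases "p x")
      case True
      obtain t1 where t1: "runs c1 (enc x) t1 (enc (f x))" "t1 \<le> b1 (esize x)"
        "esize (f x) \<le> b1 (esize x)" using c1[OF x] by blast
      have ex: "exec ?c s ((esize x + t0 + esize (p x)) + (esize (p x) + (esize x + t1 + esize (f x))))
          (s'(0 := enc (f x)))"
        using exec.IfTrue[of "Reg 1" s', OF _ exec_Call[of c1 "Reg 0" s' t1 "enc (f x)" 0]] t1 s' True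
        by (intro exec.Seq[OF e0]) (auto simp: enc_bool_def truth_def)
      show ?thesis
        unfolding s_def[symmetric] by (rule exec_result[OF ex]) (use t0 t1 True in auto)
    next
      case False
      obtain t2 where t2: "runs c2 (enc x) t2 (enc (g x))" "t2 \<le> b2 (esize x)"
        "esize (g x) \<le> b2 (esize x)" using c2[OF x] by blast
      have ex: "exec ?c s ((esize x + t0 + esize (p x)) + (esize (p x) + (esize x + t2 + esize (g x))))
          (s'(0 := enc (g x)))"
        using exec.IfFalse[of "Reg 1" s', OF _ exec_Call[of c2 "Reg 0" s' t2 "enc (g x)" 0]] t2 s' False
        by (intro exec.Seq[OF e0]) (auto simp: enc_bool_def truth_def)
      show ?thesis
        unfolding s_def[symmetric] by (rule exec_result[OF ex]) (use t0 t2 False in auto)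
    qed
  qed
qed

lemma ptime_conj [ptime_intros]:
  assumes "ptime V p" "ptime V q" shows "ptime V (\<lambda>x. p x \<and> q x)"
proof -
  have "ptime V (\<lambda>x. if p x then q x else False)" by (intro ptime_intros assms)
  then show ?thesis by (rule iffD1[OF ptime_cong, rotated]) auto
qed

lemma ptime_not [ptime_intros]:
  assumes "ptime V p" shows "ptime V (\<lambda>x. \<not> p x)"
proof -
  have "ptime V (\<lambda>x. if p x then False else True)" by (intro ptime_intros assms)
  then show ?thesis by (rule iffD1[OF ptime_cong, rotated]) auto
qed

lemma ptime_le_nat [ptime_intros]:
  assumes "ptime V f" "ptime V g" shows "ptime V (\<lambda>x. f x \<le> (g x :: nat))"
proof -
  have "ptime V (\<lambda>x. \<not> g x < f x)" by (intro ptime_intros assms)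
  then show ?thesis by (simp add: not_less)
qed

text \<open>A polynomial number of polynomial time steps may still build huge values, as repeated
  squaring shows. Therefore \<open>size\<close> demands one polynomial bound on the accumulator
  after every prefix of the list. Likewise \<open>dom\<close> restricts the step to triples that
  really occur in the loop.\<close>

lemma ptime_fold:
  assumes l: "ptime V l" and a: "ptime V a"
    and g: "ptime W (\<lambda>z. g (fst z) (fst (snd z)) (snd (snd z)))"
    and dom: "\<And>x y ys zs. x \<in> V \<Longrightarrow> l x = ys @ y # zs \<Longrightarrow> (x, y, fold (g x) ys (a x)) \<in> W"
    and q: "polyf q"
    and size: "\<And>x ys zs. x \<in> V \<Longrightarrow> l x = ys @ zs \<Longrightarrow> esize (fold (g x) ys (a x)) \<le> q (esize x)"
  shows "ptime V (\<lambda>x. fold (g x) (l x) (a x))"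
proof -
  obtain c1 b1 where b1: "polyf b1"
    and c1: "\<And>x. x \<in> V \<Longrightarrow>
      \<exists>t. runs c1 (enc x) t (enc (l x)) \<and> t \<le> b1 (esize x) \<and> esize (l x) \<le> b1 (esize x)"
    using l by (rule ptimeE) blast
  obtain c2 b2 where b2: "polyf b2"
    and c2: "\<And>x. x \<in> V \<Longrightarrow>
      \<exists>t. runs c2 (enc x) t (enc (a x)) \<and> t \<le> b2 (esize x) \<and> esize (a x) \<le> b2 (esize x)"
    using a by (rule ptimeE) blast
  obtain c3 b3 where b3: "polyf b3"
    and c3: "\<And>z. z \<in> W \<Longrightarrow>
      \<exists>t. runs c3 (enc z) t (enc (g (fst z) (fst (snd z)) (snd (snd z)))) \<and> t \<le> b3 (esize z) \<and>
          esize (g (fst z) (fst (snd z)) (snd (snd z))) \<le> b3 (esize z)"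
    using g by (rule ptimeE) blast
  \<comment> \<open>The cost of one round: the loop test, then the call with its argument
    expression, its run and its result, then the removal of the first list element. The factor 10
    generously covers the nodes of the argument expression.\<close>
  define step where
    "step = (\<lambda>n. (b1 n + 2) + (10 * (2 + n + b1 n + q n) + b3 (2 + n + b1 n + q n) + q n) + 2 * b1 n)"
  let ?b = "\<lambda>n. (n + b1 n + b1 n) + ((n + b2 n + b2 n) + ((b1 n * step n + (b1 n + 2)) + q n))"
  \<comment> \<open>Register \<open>0\<close> holds the input, register \<open>1\<close> the
    unprocessed rest of the list and register \<open>2\<close> the accumulator.\<close>
  define body where
    "body = Seq (Call 2 c3 (Mk (Reg 0) (Mk (Lft (Reg 1)) (Reg 2)))) (Assign 1 (Rgt (Reg 1)))"
  define loop where "loop = While (IsNode (Reg 1)) body"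
  let ?c = "Seq (Call 1 c1 (Reg 0)) (Seq (Call 2 c2 (Reg 0)) (Seq loop (Assign 0 (Reg 2))))"
  show ?thesis
  proof (rule ptimeI[of ?b _ ?c])
    show "polyf ?b" unfolding step_def by (intro polyf_intros polyf_comp[OF b3] b1 b2 q)
    fix x assume x: "x \<in> V"
    define n where "n = esize x"
    have lsize: "esize (l x) \<le> b1 n" using c1[OF x] by (auto simp: n_def)
    \<comment> \<open>The loop invariant, by induction on the rest \<open>zs\<close> for an
      arbitrary processed prefix \<open>ys\<close>. The summand \<open>b1 n + 2\<close> outside the
      product pays for the final failing test.\<close>
    have while: "\<exists>t s'. exec loop s t s' \<and> s' 0 = enc x \<and> s' 2 = enc (fold (g x) (ys @ zs) (a x)) \<and>
        t \<le> length zs * step n + (b1 n + 2)"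
      if "s 0 = enc x" "s 1 = enc zs" "s 2 = enc (fold (g x) ys (a x))" "l x = ys @ zs" for s ys zs
      using that
    proof (induction zs arbitrary: s ys)
      case Nil
      have "exec loop s (ecost (IsNode (Reg 1)) s) s"
        unfolding loop_def using Nil by (intro exec.WhileFalse) (auto simp: truth_def)
      moreover have "ecost (IsNode (Reg 1)) s \<le> b1 n + 2"
        using Nil lsize length_le_esize[of "l x"] by (simp add: truth_def floorlog_def)
      ultimately show ?case using Nil by auto
    next
      case (Cons z zs)
      let ?acc = "fold (g x) ys (a x)"
      let ?acc' = "g x z ?acc"
      have W: "(x, z, ?acc) \<in> W" using dom[OF x Cons.prems(4)] .
      obtain t where t: "runs c3 (enc (x, z, ?acc)) t (enc ?acc')" "t \<le> b3 (esize (x, z, ?acc))"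
        using c3[OF W] by auto
      have acc: "esize ?acc \<le> q n" using size[OF x Cons.prems(4)] by (simp add: n_def)
      have acc': "esize ?acc' \<le> q n"
        using size[OF x, of "ys @ [z]" zs] Cons.prems(4) by (simp add: n_def)
      have zs: "esize (z # zs) \<le> b1 n"
        using lsize unfolding Cons.prems(4) esize_list by simp
      have in_size: "esize (x, z, ?acc) \<le> 2 + n + b1 n + q n"
        using zs acc by (simp add: n_def)
      have b3': "b3 (esize (x, z, ?acc)) \<le> b3 (2 + n + b1 n + q n)"
        by (rule polyf_mono[OF b3 in_size])
      define s1 where "s1 = s(2 := enc ?acc')"
      define s2 where "s2 = s1(1 := enc zs)"
      have s2: "s2 0 = enc x" "s2 1 = enc zs" "s2 2 = enc (fold (g x) (ys @ [z]) (a x))"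
        "l x = (ys @ [z]) @ zs"
        using Cons.prems by (auto simp: s2_def s1_def)
      let ?e = "Mk (Reg 0) (Mk (Lft (Reg 1)) (Reg 2))"
      have e: "eval ?e s = enc (x, z, ?acc)" using Cons.prems by simp
      have ecost: "ecost ?e s \<le> 10 * (2 + n + b1 n + q n)"
        using Cons.prems zs acc by (simp add: n_def)
      have "exec (Call 2 c3 ?e) s (ecost ?e s + t + esize ?acc') s1"
        unfolding s1_def using t(1) by (intro exec_Call) (simp only: e)
      moreover have "exec (Assign 1 (Rgt (Reg 1))) s1 (ecost (Rgt (Reg 1)) s1) s2"
        unfolding s2_def by (intro exec_Assign) (use Cons.prems in \<open>simp add: s1_def\<close>)
      ultimately have "exec body s ((ecost ?e s + t + esize ?acc') + ecost (Rgt (Reg 1)) s1) s2"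
        unfolding body_def by (rule exec.Seq)
      moreover obtain t' s' where w: "exec loop s2 t' s'" "s' 0 = enc x"
        "s' 2 = enc (fold (g x) ((ys @ [z]) @ zs) (a x))" "t' \<le> length zs * step n + (b1 n + 2)"
        using Cons.IH[OF s2] by blast
      ultimately have ex: "exec loop s (ecost (IsNode (Reg 1)) s +
          ((ecost ?e s + t + esize ?acc') + ecost (Rgt (Reg 1)) s1) + t') s'"
        using w(1) Cons.prems unfolding loop_def by (intro exec.WhileTrue) (auto simp: truth_def)
      have "ecost (IsNode (Reg 1)) s \<le> b1 n + 2"
        using Cons.prems zs by (simp add: truth_def floorlog_def)
      moreover have "ecost (Rgt (Reg 1)) s1 \<le> 2 * b1 n"
        using Cons.prems zs by (auto simp: s1_def)
      ultimately have "ecost (IsNode (Reg 1)) s +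
          ((ecost ?e s + t + esize ?acc') + ecost (Rgt (Reg 1)) s1) \<le> step n"
        using ecost t(2) b3' acc' unfolding step_def by linarith
      then have "ecost (IsNode (Reg 1)) s +
          ((ecost ?e s + t + esize ?acc') + ecost (Rgt (Reg 1)) s1) + t'
          \<le> length (z # zs) * step n + (b1 n + 2)"
        using w(4) by simp
      moreover have "s' 2 = enc (fold (g x) (ys @ z # zs) (a x))" using w(3) by simp
      ultimately show ?case using ex w(2) by blast
    qed
    define s where "s = start (enc x)"
    have s0: "s 0 = enc x" by (simp add: s_def start_def)
    obtain t1 where t1: "runs c1 (enc x) t1 (enc (l x))" "t1 \<le> b1 n" using c1[OF x] n_def by blast
    obtain t2 where t2: "runs c2 (enc x) t2 (enc (a x))" "t2 \<le> b2 n" "esize (a x) \<le> b2 n"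
      using c2[OF x] n_def by blast
    let ?s' = "s(1 := enc (l x), 2 := enc (a x))"
    obtain t3 s3 where w: "exec loop ?s' t3 s3" "s3 2 = enc (fold (g x) (l x) (a x))"
      "t3 \<le> length (l x) * step n + (b1 n + 2)"
      using while[of ?s' "l x" "[]"] s0 by auto
    have len: "length (l x) * step n \<le> b1 n * step n"
      using lsize length_le_esize[of "l x"] by (intro mult_right_mono) auto
    have ex: "exec ?c s ((n + t1 + esize (l x)) +
        ((n + t2 + esize (a x)) + (t3 + esize (fold (g x) (l x) (a x)))))
        (s3(0 := enc (fold (g x) (l x) (a x))))"
      using exec_Call[of c1 "Reg 0" s t1 "enc (l x)" 1]
        exec_Call[of c2 "Reg 0" "s(1 := enc (l x))" t2 "enc (a x)" 2] t1 t2 s0 w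
        exec_Assign[of "enc (fold (g x) (l x) (a x))" "Reg 2" s3 0]
      by (intro exec.Seq) (auto simp: n_def)
    have "esize (fold (g x) (l x) (a x)) \<le> q n"
      using size[OF x, of "l x" "[]"] by (simp add: n_def)
    then have "(n + t1 + esize (l x)) +
        ((n + t2 + esize (a x)) + (t3 + esize (fold (g x) (l x) (a x)))) \<le> ?b n"
      using t1(2) t2(2,3) w(3) lsize len by linarith
    then show "\<exists>t s. exec ?c (start (enc x)) t s \<and>
        s 0 = enc (fold (g x) (l x) (a x)) \<and> t \<le> ?b (esize x)"
      unfolding s_def[symmetric] n_def[symmetric]
      by (intro exec_result[OF ex]) auto
  qed
qed

text \<open>A function of several arguments is treated once, uncurried and on all inputs; arbitrary
  polynomial time arguments are then composed with it.\<close>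

lemma ptime_apply3:
  assumes "ptime UNIV (\<lambda>w. h (fst w) (fst (snd w)) (snd (snd w)))" "ptime V a" "ptime V b" "ptime V c"
  shows "ptime V (\<lambda>x. h (a x) (b x) (c x))"
  using ptime_compose[OF assms(1) ptime_Pair[OF assms(2) ptime_Pair[OF assms(3,4)]]] by simp

lemma ptime_apply4:
  assumes "ptime UNIV (\<lambda>w. h (fst w) (fst (snd w)) (fst (snd (snd w))) (snd (snd (snd w))))"
    "ptime V a" "ptime V b" "ptime V c" "ptime V d"
  shows "ptime V (\<lambda>x. h (a x) (b x) (c x) (d x))"
  using ptime_compose[OF assms(1)
      ptime_Pair[OF assms(2) ptime_Pair[OF assms(3) ptime_Pair[OF assms(4,5)]]]] by simp

section \<open>Polynomial time list operations\<close>

text \<open>The accumulator is always the start value or an element of the list, so its size needs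
  no separate bound.\<close>

lemma ptime_fold_select:
  assumes l: "ptime V l" and a: "ptime V a"
    and g: "ptime UNIV (\<lambda>z. g (fst z) (fst (snd z)) (snd (snd z)))"
    and sel: "\<And>x y acc. g x y acc = y \<or> g x y acc = acc"
  shows "ptime V (\<lambda>x. fold (g x) (l x) (a x))"
proof -
  obtain c1 b1 where b1: "polyf b1"
    and c1: "\<And>x. x \<in> V \<Longrightarrow>
      \<exists>t. runs c1 (enc x) t (enc (l x)) \<and> t \<le> b1 (esize x) \<and> esize (l x) \<le> b1 (esize x)"
    using l by (rule ptimeE) blast
  obtain c2 b2 where b2: "polyf b2"
    and c2: "\<And>x. x \<in> V \<Longrightarrow>
      \<exists>t. runs c2 (enc x) t (enc (a x)) \<and> t \<le> b2 (esize x) \<and> esize (a x) \<le> b2 (esize x)"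
    using a by (rule ptimeE) blast
  have mem: "fold (g x) ys acc \<in> insert acc (set ys)" for x ys acc
    by (induction ys arbitrary: acc) (use sel in \<open>auto, metis\<close>)
  show ?thesis
  proof (rule ptime_fold[OF l a g, where q = "\<lambda>n. b1 n + b2 n"])
    show "polyf (\<lambda>n. b1 n + b2 n)" by (intro polyf_intros b1 b2)
    fix x ys zs assume x: "x \<in> V" "l x = ys @ zs"
    have "esize (l x) \<le> b1 (esize x)" "esize (a x) \<le> b2 (esize x)"
      using c1[OF x(1)] c2[OF x(1)] by auto
    moreover have "esize (fold (g x) ys (a x)) \<le> esize (l x) + esize (a x)"
      using mem[of x ys "a x"] member_esize[of "fold (g x) ys (a x)" "l x"] x(2) by fastforce
    ultimately show "esize (fold (g x) ys (a x)) \<le> b1 (esize x) + b2 (esize x)" by linarith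
  qed auto
qed

text \<open>The accumulator is never longer than the part of the list already read and contains only
  elements of it. Length times element size gives a quadratic bound.\<close>

lemma ptime_fold_collect:
  assumes l: "ptime V l"
    and g: "ptime UNIV (\<lambda>z. g (fst z) (fst (snd z)) (snd (snd z)))"
    and set: "\<And>x y acc. set (g x y acc) \<subseteq> insert y (set acc)"
    and length: "\<And>x y acc. length (g x y acc) \<le> Suc (length acc)"
  shows "ptime V (\<lambda>x. fold (g x) (l x) [])"
proof -
  obtain c1 b1 where b1: "polyf b1"
    and c1: "\<And>x. x \<in> V \<Longrightarrow>
      \<exists>t. runs c1 (enc x) t (enc (l x)) \<and> t \<le> b1 (esize x) \<and> esize (l x) \<le> b1 (esize x)"
    using l by (rule ptimeE) blast
  have inv: "set (fold (g x) ys acc) \<subseteq> set ys \<union> set acc \<and>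
      length (fold (g x) ys acc) \<le> length ys + length acc" for x ys acc
  proof (induction ys arbitrary: acc)
    case (Cons y ys)
    show ?case using Cons[of "g x y acc"] set[of x y acc] length[of x y acc] by auto
  qed simp
  show ?thesis
  proof (rule ptime_fold[OF l ptime_const g, where q = "\<lambda>n. 1 + b1 n * (1 + b1 n)"])
    show "polyf (\<lambda>n. 1 + b1 n * (1 + b1 n))" by (intro polyf_intros b1)
    fix x ys zs assume x: "x \<in> V" "l x = ys @ zs"
    have *: "esize (l x) \<le> b1 (esize x)" using c1[OF x(1)] by auto
    show "esize (fold (g x) ys []) \<le> 1 + b1 (esize x) * (1 + b1 (esize x))"
    proof (rule esize_list_le)
      fix y assume "y \<in> set (fold (g x) ys [])"
      then have "y \<in> set (l x)" using inv[of x ys "[]"] x(2) by auto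
      then show "esize y \<le> b1 (esize x)" using member_esize * by fastforce
    next
      have "length (fold (g x) ys []) \<le> length (l x)" using inv[of x ys "[]"] x(2) by simp
      then show "length (fold (g x) ys []) \<le> b1 (esize x)"
        using length_le_esize[of "l x"] * by linarith
    qed
  qed auto
qed

lemma ptime_rev [ptime_intros]:
  assumes "ptime V l" shows "ptime V (\<lambda>x. rev (l x))"
proof -
  have "ptime V (\<lambda>x. fold (\<lambda>y acc. y # acc) (l x) [])"
    by (rule ptime_fold_collect[OF assms]) (auto intro!: ptime_intros)
  then show ?thesis by (simp add: fold_Cons_rev)
qed

lemma ptime_append [ptime_intros]:
  assumes f: "ptime V f" and g: "ptime V g" shows "ptime V (\<lambda>x. f x @ g x)"
proof -
  obtain c1 b1 where b1: "polyf b1"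
    and c1: "\<And>x. x \<in> V \<Longrightarrow>
      \<exists>t. runs c1 (enc x) t (enc (f x)) \<and> t \<le> b1 (esize x) \<and> esize (f x) \<le> b1 (esize x)"
    using f by (rule ptimeE) blast
  obtain c2 b2 where b2: "polyf b2"
    and c2: "\<And>x. x \<in> V \<Longrightarrow>
      \<exists>t. runs c2 (enc x) t (enc (g x)) \<and> t \<le> b2 (esize x) \<and> esize (g x) \<le> b2 (esize x)"
    using g by (rule ptimeE) blast
  \<comment> \<open>Moving elements one at a time to the front of the second list reverses them,
    which the initial \<open>rev\<close> compensates.\<close>
  have "ptime V (\<lambda>x. fold (\<lambda>y acc. y # acc) (rev (f x)) (g x))"
  proof (rule ptime_fold[where W = UNIV and q = "\<lambda>n. b1 n + b2 n" and l = "\<lambda>x. rev (f x)"])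
    show "polyf (\<lambda>n. b1 n + b2 n)" by (intro polyf_intros b1 b2)
    fix x ys zs assume x: "x \<in> V" "rev (f x) = ys @ zs"
    have "f x = rev zs @ rev ys" using x(2) by (metis rev_append rev_rev_ident)
    then have "esize (rev ys @ g x) \<le> esize (f x) + esize (g x)"
      by (simp add: esize_list)
    then show "esize (fold (\<lambda>y acc. y # acc) ys (g x)) \<le> b1 (esize x) + b2 (esize x)"
      using c1[OF x(1)] c2[OF x(1)] by (auto simp: fold_Cons_rev)
  qed (auto intro!: ptime_intros f g)
  then show ?thesis by (simp add: fold_Cons_rev)
qed

lemma ptime_filter [ptime_intros]:
  assumes l: "ptime V l" and P: "ptime UNIV (\<lambda>z. P (fst z) (snd z))"
  shows "ptime V (\<lambda>x. filter (P x) (l x))"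
proof -
  have "rev (fold (\<lambda>y acc. if Q y then y # acc else acc) ys zs) = rev zs @ filter Q ys"
    for Q and ys zs :: "'b list"
    by (induction ys arbitrary: zs) auto
  note * = this[of _ _ "[]"]
  have P': "ptime UNIV (\<lambda>z :: 'a \<times> 'b \<times> 'b list. P (fst z) (fst (snd z)))"
    using ptime_compose[OF P, of UNIV "\<lambda>z. (fst z, fst (snd z))"]
    by (simp add: ptime_Pair ptime_fst ptime_snd ptime_id)
  have "ptime V (\<lambda>x. rev (fold (\<lambda>y acc. if P x y then y # acc else acc) (l x) []))"
    by (intro ptime_rev ptime_fold_collect l ptime_if P' ptime_Cons ptime_fst ptime_snd ptime_id) auto
  then show ?thesis by (simp add: *)
qed

text \<open>The version with a domain \<open>W\<close> is the one that can apply the given PCM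
  algorithm to each member of a list of valid instances.\<close>

lemma ptime_map_on:
  assumes l: "ptime V l" and h: "ptime W (\<lambda>z. h (fst z) (snd z))"
    and dom: "\<And>x y. x \<in> V \<Longrightarrow> y \<in> set (l x) \<Longrightarrow> (x, y) \<in> W"
  shows "ptime V (\<lambda>x. map (h x) (l x))"
proof -
  obtain c1 b1 where b1: "polyf b1"
    and c1: "\<And>x. x \<in> V \<Longrightarrow>
      \<exists>t. runs c1 (enc x) t (enc (l x)) \<and> t \<le> b1 (esize x) \<and> esize (l x) \<le> b1 (esize x)"
    using l by (rule ptimeE) blast
  obtain c2 b2 where b2: "polyf b2"
    and c2: "\<And>z. z \<in> W \<Longrightarrow>
      \<exists>t. runs c2 (enc z) t (enc (h (fst z) (snd z))) \<and> t \<le> b2 (esize z) \<and>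
        esize (h (fst z) (snd z)) \<le> b2 (esize z)"
    using h by (rule ptimeE) blast
  have "fold (\<lambda>y acc. h x y # acc) ys zs = rev (map (h x) ys) @ zs" for x ys zs
    by (induction ys arbitrary: zs) auto
  note fold = this[of _ _ "[]", unfolded append_Nil2]
  let ?W = "{z :: 'a \<times> 'b \<times> 'c list. (fst z, fst (snd z)) \<in> W}"
  have "ptime ?W (\<lambda>z. (\<lambda>z. h (fst z) (snd z)) (fst z, fst (snd z)) # snd (snd z))"
    by (intro ptime_Cons ptime_compose[OF h, of _ "\<lambda>z. (fst z, fst (snd z))"] ptime_intros) auto
  then have g: "ptime ?W (\<lambda>z. h (fst z) (fst (snd z)) # snd (snd z))" by simp
  \<comment> \<open>There are at most \<open>b1 n\<close> results, and each is bounded by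
    \<open>b2\<close> at the size of a pair of the input and a list element.\<close>
  let ?q = "\<lambda>n. 1 + b1 n * (1 + b2 (1 + n + b1 n))"
  have "ptime V (\<lambda>x. fold (\<lambda>y acc. h x y # acc) (l x) [])"
  proof (rule ptime_fold[OF l ptime_const g, where q = ?q])
    show "polyf ?q" by (intro polyf_intros b1 polyf_comp[OF b2])
    fix x ys zs assume x: "x \<in> V" "l x = ys @ zs"
    have *: "esize (l x) \<le> b1 (esize x)" using c1[OF x(1)] by auto
    show "esize (fold (\<lambda>y acc. h x y # acc) ys []) \<le> ?q (esize x)"
      unfolding fold
    proof (rule esize_list_le)
      fix w assume "w \<in> set (rev (map (h x) ys))"
      then obtain y where y: "y \<in> set (l x)" "w = h x y" using x(2) by auto
      have "esize (x, y) \<le> 1 + esize x + b1 (esize x)" using member_esize[OF y(1)] * by simp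
      then have "b2 (esize (x, y)) \<le> b2 (1 + esize x + b1 (esize x))" by (rule polyf_mono[OF b2])
      then show "esize w \<le> b2 (1 + esize x + b1 (esize x))"
        using c2[OF dom[OF x(1) y(1)]] y(2) by auto
    next
      have "length ys \<le> length (l x)" using x(2) by simp
      then show "length (rev (map (h x) ys)) \<le> b1 (esize x)"
        using length_le_esize[of "l x"] * by simp
    qed
  qed (auto intro: dom)
  then have "ptime V (\<lambda>x. rev (fold (\<lambda>y acc. h x y # acc) (l x) []))" by (rule ptime_rev)
  then show ?thesis by (simp add: fold)
qed

lemma ptime_map [ptime_intros]:
  "ptime V l \<Longrightarrow> ptime UNIV (\<lambda>z. h (fst z) (snd z)) \<Longrightarrow> ptime V (\<lambda>x. map (h x) (l x))"
  by (rule ptime_map_on) auto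

lemma ptime_concat [ptime_intros]:
  fixes l :: "'a::enc \<Rightarrow> 'b::enc list list"
  assumes l: "ptime V l" shows "ptime V (\<lambda>x. concat (l x))"
proof -
  obtain c1 b1 where b1: "polyf b1"
    and c1: "\<And>x. x \<in> V \<Longrightarrow>
      \<exists>t. runs c1 (enc x) t (enc (l x)) \<and> t \<le> b1 (esize x) \<and> esize (l x) \<le> b1 (esize x)"
    using l by (rule ptimeE) blast
  have fold: "fold (\<lambda>y acc. acc @ y) ys zs = zs @ concat ys" for ys and zs :: "'b list"
    by (induction ys arbitrary: zs) auto
  \<comment> \<open>Flattening only discards the outer nodes and the inner end markers.\<close>
  have size: "esize (concat ys) \<le> esize ys" for ys :: "'b list list"
    by (induction ys) (auto simp: esize_list)
  have "ptime V (\<lambda>x. fold (\<lambda>y acc. acc @ y) (l x) [])"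
  proof (rule ptime_fold[OF l ptime_const, where W = UNIV and q = b1])
    fix x ys zs assume x: "x \<in> V" "l x = ys @ zs"
    have "esize ys \<le> esize (l x)" by (simp add: x(2) esize_list)
    then show "esize (fold (\<lambda>y acc. acc @ y) ys []) \<le> b1 (esize x)"
      using size[of ys] c1[OF x(1)] by (auto simp: fold)
  qed (auto intro!: ptime_intros b1)
  then show ?thesis by (simp add: fold)
qed

lemma ptime_length [ptime_intros]:
  fixes l :: "'a::enc \<Rightarrow> 'b::enc list"
  assumes l: "ptime V l" shows "ptime V (\<lambda>x. length (l x))"
proof -
  obtain c1 b1 where b1: "polyf b1"
    and c1: "\<And>x. x \<in> V \<Longrightarrow>
      \<exists>t. runs c1 (enc x) t (enc (l x)) \<and> t \<le> b1 (esize x) \<and> esize (l x) \<le> b1 (esize x)"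
    using l by (rule ptimeE) blast
  have fold: "fold (\<lambda>y n. n + 1) ys n = n + length ys" for ys :: "'b list" and n
    by (induction ys arbitrary: n) auto
  have "ptime V (\<lambda>x. fold (\<lambda>y n. n + 1) (l x) (0::nat))"
  proof (rule ptime_fold[OF l ptime_const, where W = UNIV and q = "\<lambda>n. 1 + b1 n"])
    fix x ys zs assume x: "x \<in> V" "l x = ys @ zs"
    have "length ys < esize (l x)" using length_le_esize[of "l x"] x(2) by simp
    then show "esize (fold (\<lambda>y n. n + 1) ys (0::nat)) \<le> 1 + b1 (esize x)"
      using c1[OF x(1)] esize_nat_le[of "length ys"] unfolding fold by auto
  qed (intro ptime_intros polyf_intros b1 | simp)+
  then show ?thesis using fold by simp
qed

section \<open>The algorithm\<close>

type_synonym entry = "nat \<times> nat \<times> nat \<times> nat \<times> nat"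

text \<open>
  The five components of an entry \<open>(x, y, a, b, 0)\<close> are \<open>x\<close>, \<open>y\<close>, the numerator and the
  denominator of \<open>d x y\<close>, and the end marker of the list. A radius is a pair of a numerator
  and a denominator.
\<close>

definition near :: "nat \<Rightarrow> entry list \<Rightarrow> nat \<times> nat \<Rightarrow> nat \<Rightarrow> nat \<Rightarrow> bool" where
  "near k es r x y \<longleftrightarrow>
     filter (\<lambda>e. fst e = x \<and> fst (snd e) = y \<and>
       fst (snd (snd e)) * snd r \<le> k * fst r * fst (snd (snd (snd e)))) es \<noteq> []"

lemma ptime_near [ptime_intros]:
  assumes "ptime V es" "ptime V r" "ptime V x" "ptime V y"
  shows "ptime V (\<lambda>v. near k (es v) (r v) (x v) (y v))"
  by (rule ptime_apply4[OF _ assms]) (unfold near_def, intro ptime_nonempty ptime_intros)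

section \<open>Sorting pairs of a load and a customer by load, and choosing heads\<close>

definition insert_load :: "nat \<times> nat \<Rightarrow> (nat \<times> nat) list \<Rightarrow> (nat \<times> nat) list" where
  "insert_load p ps = filter (\<lambda>q. fst q \<le> fst p) ps @ p # filter (\<lambda>q. fst p < fst q) ps"

definition sort_load :: "(nat \<times> nat) list \<Rightarrow> (nat \<times> nat) list" where
  "sort_load ps = fold insert_load ps []"

lemma set_insert_load: "set (insert_load p ps) = insert p (set ps)"
  by (auto simp: insert_load_def)

lemma length_insert_load: "length (insert_load p ps) = Suc (length ps)"
  using sum_length_filter_compl[of "\<lambda>q. fst q \<le> fst p" ps]
  by (simp add: insert_load_def not_le)

lemma sorted_insert_load:
  "sorted (map fst ps) \<Longrightarrow> sorted (map fst (insert_load p ps))"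
  by (auto simp: insert_load_def sorted_append sorted_map sorted_wrt_filter)

lemma set_sort_load: "set (sort_load ps) = set ps"
proof -
  have "set (fold insert_load ps qs) = set ps \<union> set qs" for qs
    by (induction ps arbitrary: qs) (auto simp: set_insert_load)
  then show ?thesis by (simp add: sort_load_def)
qed

lemma sorted_sort_load: "sorted (map fst (sort_load ps))"
proof -
  have "sorted (map fst qs) \<Longrightarrow> sorted (map fst (fold insert_load ps qs))" for qs
    by (induction ps arbitrary: qs) (auto simp: sorted_insert_load)
  then show ?thesis by (simp add: sort_load_def)
qed

lemma ptime_sort_load [ptime_intros]:
  assumes "ptime V l" shows "ptime V (\<lambda>x. sort_load (l x))"
  unfolding sort_load_def
proof (rule ptime_fold_collect[OF assms])
  show "ptime UNIV (\<lambda>z :: _ \<times> (nat \<times> nat) \<times> _. insert_load (fst (snd z)) (snd (snd z)))"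
    unfolding insert_load_def by (intro ptime_intros)
qed (auto simp: set_insert_load length_insert_load)

text \<open>A new head is put in front, so a later position in the list means an earlier
  selection.\<close>

definition reps :: "entry list \<Rightarrow> nat \<times> nat \<Rightarrow> (nat \<times> nat) list \<Rightarrow> (nat \<times> nat) list" where
  "reps es r ps = fold
     (\<lambda>p R. if filter (\<lambda>q. near 2 es r (snd q) (snd p)) R \<noteq> [] then R else p # R) (sort_load ps) []"

lemma ptime_reps [ptime_intros]:
  assumes "ptime V es" "ptime V r" "ptime V ps"
  shows "ptime V (\<lambda>v. reps (es v) (r v) (ps v))"
  by (rule ptime_apply3[OF _ assms], unfold reps_def, rule ptime_fold_collect)
    (intro ptime_nonempty ptime_intros | auto)+

definition rep ::
  "entry list \<Rightarrow> nat \<times> nat \<Rightarrow> (nat \<times> nat) list \<Rightarrow> nat \<times> nat \<Rightarrow> nat \<times> nat" where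
  "rep es r R p =
     fold (\<lambda>q acc. if near 2 es r (snd q) (snd p) \<and> fst q \<le> fst acc then q else acc) R p"

lemma ptime_rep [ptime_intros]:
  assumes "ptime V es" "ptime V r" "ptime V R" "ptime V p"
  shows "ptime V (\<lambda>v. rep (es v) (r v) (R v) (p v))"
  by (rule ptime_apply4[OF _ assms], unfold rep_def, rule ptime_fold_select)
    (intro ptime_intros | auto)+

definition add_loads :: "entry list \<Rightarrow> nat \<times> nat \<Rightarrow> (nat \<times> nat) list \<Rightarrow> (nat \<times> nat) list" where
  "add_loads es r ps =
     map (\<lambda>p. (fst p + length (filter (\<lambda>q. snd (rep es r (reps es r ps) q) = snd p) ps), snd p)) ps"

lemma ptime_add_loads [ptime_intros]:
  assumes "ptime V es" "ptime V r" "ptime V ps"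
  shows "ptime V (\<lambda>v. add_loads (es v) (r v) (ps v))"
  by (rule ptime_apply3[OF _ assms]) (unfold add_loads_def, intro ptime_intros)

text \<open>The components are the facilities, the description, the parts, the values and the end
  marker. A value is a list of zeros, that is, a number in unary.\<close>

type_synonym pcm_input = "nat list \<times> data \<times> nat list list \<times> (nat \<times> nat list) list \<times> nat"

text \<open>Empty balls are removed because a partition has no empty part.\<close>

definition pcm_of ::
  "nat list \<Rightarrow> data \<Rightarrow> entry list \<Rightarrow> nat \<times> nat \<Rightarrow> (nat \<times> nat) list \<Rightarrow> pcm_input" where
  "pcm_of fs \<delta> es r ps =
     (fs, \<delta>,
      filter (\<lambda>b. b \<noteq> []) (map (\<lambda>q. filter (\<lambda>f. near 1 es r (snd q) f) fs) (reps es r ps)),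
      map (\<lambda>f. (f, map (\<lambda>_. 0)
        (filter (\<lambda>q. near 1 es r (snd (rep es r (reps es r ps) q)) f) ps))) fs,
      0)"

lemma ptime_pcm_of [ptime_intros]:
  assumes "ptime V fs" "ptime V \<delta>" "ptime V es" "ptime V r" "ptime V ps"
  shows "ptime V (\<lambda>v. pcm_of (fs v) (\<delta> v) (es v) (r v) (ps v))"
  by (rule ptime_apply4[OF _ ptime_Pair[OF assms(1,2)] assms(3-5),
        where h = "\<lambda>a. pcm_of (fst a) (snd a)", simplified fst_conv snd_conv])
    (unfold pcm_of_def, intro ptime_nonempty ptime_intros)

text \<open>A loop counter in the form of a list, to be consumed by a fold. Its length exceeds the
  bound of \<open>perceptron_bound\<close> by one, which forces some round to succeed.\<close>

definition ticks :: "'a list \<Rightarrow> nat list" where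
  "ticks cs = 0 # concat (map (\<lambda>_. concat (map (\<lambda>_. map (\<lambda>_. 0) cs) cs)) cs)"

lemma length_ticks: "length (ticks cs) = length cs ^ 3 + 1"
  by (simp add: ticks_def length_concat sum_list_triv comp_def power3_eq_cube)

lemma ptime_ticks [ptime_intros]: "ptime V l \<Longrightarrow> ptime V (\<lambda>x. ticks (l x))"
  by (rule ptime_compose[where W = UNIV]) (unfold ticks_def, intro ptime_intros, auto)

definition loads_step ::
  "entry list \<Rightarrow> nat \<times> nat \<Rightarrow> (nat \<times> nat) list \<times> (nat \<times> nat) list list \<Rightarrow>
   (nat \<times> nat) list \<times> (nat \<times> nat) list list" where
  "loads_step es r st = (add_loads es r (fst st), fst st # snd st)"

text \<open>Each step records the loads before it updates them, so \<open>n\<close> ticks yield the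
  loads of rounds \<open>0\<close> to \<open>n - 1\<close>, starting with the zero loads.\<close>

definition loads_trace :: "entry list \<Rightarrow> nat \<times> nat \<Rightarrow> nat list \<Rightarrow> (nat \<times> nat) list list" where
  "loads_trace es r cs = snd (fold (\<lambda>_. loads_step es r) (ticks cs) (map (\<lambda>c. (0, c)) cs, []))"

text \<open>A round adds at most \<open>length cs\<close> to any load, so loads grow linearly with
  the number of rounds and the trace remains of polynomial size.\<close>

lemma esize_loads_trace:
  assumes "length ys \<le> N"
  shows "esize (fold (\<lambda>_. loads_step es r) ys (map (\<lambda>c. (0, c)) cs, []))
    \<le> 1 + (1 + N) * (1 + (1 + (1 + length cs) * (1 + (2 + length cs * N + esize cs))))"
proof -
  define ok where "ok k ps \<longleftrightarrow> length ps = length cs \<and>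
    (\<forall>p\<in>set ps. fst p \<le> length cs * k \<and> snd p \<in> set cs)" for k and ps :: "(nat \<times> nat) list"
  have step: "ok (Suc k) (add_loads es r ps)" if "ok k ps" for k ps
  proof -
    have "fst p + length (filter Q ps) \<le> length cs * Suc k" if "p \<in> set ps" for p Q
      using \<open>ok k ps\<close> that length_filter_le[of Q ps] unfolding ok_def by fastforce
    then show ?thesis using that by (auto simp: ok_def add_loads_def)
  qed
  let ?st = "\<lambda>ys. fold (\<lambda>_. loads_step es r) ys (map (\<lambda>c. (0, c)) cs, [])"
  have "ok (length ys) (fst (?st ys)) \<and> length (snd (?st ys)) = length ys \<and>
    (\<forall>ps\<in>set (snd (?st ys)). \<exists>k\<le>length ys. ok k ps)" for ys :: "'a list"
  proof (induction ys rule: rev_induct)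
    case Nil
    show ?case by (auto simp: ok_def)
  next
    case (snoc y ys)
    have eq: "?st (ys @ [y]) = (add_loads es r (fst (?st ys)), fst (?st ys) # snd (?st ys))"
      by (simp add: loads_step_def)
    have *: "ok (length ys) (fst (?st ys))" using snoc by simp
    then have "\<exists>k\<le>length (ys @ [y]). ok k (fst (?st ys))" by (intro exI[of _ "length ys"]) auto
    moreover have "\<exists>k\<le>length (ys @ [y]). ok k ps" if "ps \<in> set (snd (?st ys))" for ps
      using snoc that le_SucI by fastforce
    ultimately show ?case using snoc step[OF *] unfolding eq by auto
  qed
  note inv = this[of ys]
  let ?B = "2 + length cs * N + esize cs"
  let ?C = "1 + (1 + length cs) * (1 + ?B)"
  have ps: "esize ps \<le> ?C" if ok: "ok k ps" "k \<le> length ys" for k ps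
  proof (rule esize_list_le)
    fix p assume "p \<in> set ps"
    then have p: "fst p \<le> length cs * k" "snd p \<in> set cs" using ok by (auto simp: ok_def)
    have "length cs * k \<le> length cs * N" using ok(2) assms by simp
    then have "esize (fst p) \<le> 1 + length cs * N" using esize_nat_le[of "fst p"] p(1) by linarith
    moreover have "esize p = 1 + esize (fst p) + esize (snd p)" by (cases p) simp
    ultimately show "esize p \<le> ?B" using member_esize[OF p(2)] by linarith
  qed (use ok in \<open>simp add: ok_def\<close>)
  \<comment> \<open>A pair of an element and a list has the same code as the list with that element
    in front, so the state is measured as a single list.\<close>
  have "esize (fst (?st ys) # snd (?st ys)) \<le> 1 + (1 + N) * (1 + ?C)"
  proof (rule esize_list_le)
    show "esize qs \<le> ?C" if "qs \<in> set (fst (?st ys) # snd (?st ys))" for qs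
      using that inv ps by auto
  qed (use inv assms in simp)
  then show ?thesis by (simp add: enc_prod_def[of "?st ys"])
qed

lemma ptime_loads_trace [ptime_intros]:
  assumes "ptime V es" "ptime V r" "ptime V cs"
  shows "ptime V (\<lambda>v. loads_trace (es v) (r v) (cs v))"
proof -
  \<comment> \<open>The number of ticks in terms of the input size, which exceeds the number of
    customers.\<close>
  let ?N = "\<lambda>n. n ^ 3 + 1"
  show ?thesis
  proof (rule ptime_apply3[OF _ assms], unfold loads_trace_def, rule ptime_snd, rule ptime_fold)
    show "ptime UNIV (\<lambda>z :: (entry list \<times> (nat \<times> nat) \<times> nat list) \<times> nat \<times> _.
        loads_step (fst (fst z)) (fst (snd (fst z))) (snd (snd z)))"
      unfolding loads_step_def by (intro ptime_intros)
    show "polyf (\<lambda>n. 1 + (1 + ?N n) * (1 + (1 + (1 + n) * (1 + (2 + n * ?N n + n)))))"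
      by (intro polyf_intros)
    fix w :: "entry list \<times> (nat \<times> nat) \<times> nat list" and ys zs
    obtain es r cs where w: "w = (es, r, cs)" by (cases w)
    assume "ticks (snd (snd w)) = ys @ zs"
    then have "length ys \<le> length cs ^ 3 + 1" using length_ticks[of cs] by (simp add: w)
    moreover have n: "length cs \<le> esize w" "esize cs \<le> esize w"
      using length_le_esize[of cs] by (auto simp: w)
    moreover have "length cs ^ 3 \<le> esize w ^ 3" using n(1) by (rule power_mono) simp
    ultimately have "length ys \<le> ?N (esize w)" by linarith
    note esize_loads_trace[OF this, of es r cs]
    also have "1 + (1 + ?N (esize w)) * (1 + (1 + (1 + length cs) * (1 + (2 + length cs * ?N (esize w) + esize cs))))
      \<le> 1 + (1 + ?N (esize w)) * (1 + (1 + (1 + esize w) * (1 + (2 + esize w * ?N (esize w) + esize w))))"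
      using n by (intro add_mono mult_mono order_refl) auto
    finally show "esize (fold (\<lambda>_. loads_step (fst w) (fst (snd w))) ys
        (map (\<lambda>c. (0, c)) (snd (snd w)), []))
      \<le> 1 + (1 + ?N (esize w)) * (1 + (1 + (1 + esize w) * (1 + (2 + esize w * ?N (esize w) + esize w))))"
      by (simp add: w)
  qed (intro ptime_intros | simp)+
qed

section \<open>Candidates over all radii and rounds\<close>

type_synonym supplier_input = "nat list \<times> nat list \<times> entry list \<times> nat \<times> data \<times> nat"

text \<open>The radii are the distances of all pairs of points; a finite optimum attained with a
  nonempty set of customers is one of them.\<close>

definition subproblems :: "supplier_input \<Rightarrow> (pcm_input \<times> nat \<times> nat) list" where
  "subproblems x =
     (let fs = fst x; cs = fst (snd x); es = fst (snd (snd x)); \<delta> = fst (snd (snd (snd (snd x))))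
      in concat (map (\<lambda>e. let r = (fst (snd (snd e)), fst (snd (snd (snd e)))) in
           map (\<lambda>ps. (pcm_of fs \<delta> es r ps, r)) (loads_trace es r cs)) es))"

text \<open>A trivial valid PCM instance. It supplies a member of the relaxation when there is no
  candidate, as for a supplier instance without a solution.\<close>

definition fallback :: "supplier_input \<Rightarrow> pcm_input" where
  "fallback x =
     (fst x, fst (snd (snd (snd (snd x)))), [], map (\<lambda>f. (f, [])) (fst x), 0)"

text \<open>Success is tested by counting the customers served within three times the radius; the
  PCM value need not be recomputed.\<close>

definition candidates ::
  "(pcm_input \<Rightarrow> nat list) \<Rightarrow> supplier_input \<Rightarrow> (nat list \<times> nat \<times> nat) list" where
  "candidates alg x =
     (let cs = fst (snd x); es = fst (snd (snd x)); m = fst (snd (snd (snd x)))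
      in filter (\<lambda>s. m \<le> length (filter (\<lambda>u. filter (\<lambda>f. near 3 es (snd s) u f) (fst s) \<noteq> []) cs))
           (map (\<lambda>i. (alg (fst i), snd i)) (subproblems x)))"

text \<open>The radius \<open>(1, 0)\<close> stands for infinity: it exceeds every \<open>(a, b)\<close> with \<open>0 < b\<close>.\<close>

definition best_candidate :: "(pcm_input \<Rightarrow> nat list) \<Rightarrow> supplier_input \<Rightarrow> nat list \<times> nat \<times> nat" where
  "best_candidate alg x =
     fold (\<lambda>s acc. if fst (snd s) * snd (snd acc) < fst (snd acc) * snd (snd s) then s else acc)
       (candidates alg x) (alg (fallback x), 1, 0)"

lemma ptime_subproblems: "ptime UNIV subproblems"
  unfolding subproblems_def[abs_def] Let_def by (intro ptime_intros)

lemma ptime_best_candidate: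
  assumes alg: "ptime W alg"
    and dom: "\<And>x i. x \<in> V \<Longrightarrow> i \<in> set (subproblems x) \<Longrightarrow> fst i \<in> W"
    and dom': "\<And>x. x \<in> V \<Longrightarrow> fallback x \<in> W"
  shows "ptime V (\<lambda>x. fst (best_candidate alg x))"
proof -
  have sub: "ptime V subproblems" by (rule ptime_mono[OF ptime_subproblems]) simp
  have cand: "ptime V (candidates alg)"
    unfolding candidates_def[abs_def] Let_def
  proof (rule ptime_filter)
    show "ptime V (\<lambda>x. map (\<lambda>i. (alg (fst i), snd i)) (subproblems x))"
      \<comment> \<open>The mapped function receives the whole input together with one subproblem,
        but only the subproblem has to be a valid PCM instance.\<close>
      by (rule ptime_map_on[OF sub, where W = "{z. fst (snd z) \<in> W}"])
        (intro ptime_intros ptime_compose[OF alg] | simp add: dom)+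
  qed (intro ptime_nonempty ptime_intros)
  have fb: "ptime V (\<lambda>x. alg (fallback x))"
    by (rule ptime_compose[OF alg], unfold fallback_def, intro ptime_intros)
      (use dom' in \<open>simp add: fallback_def\<close>)
  show ?thesis
    unfolding best_candidate_def
    by (rule ptime_fst, rule ptime_fold_select[OF cand])
      (intro ptime_intros fb | simp)+
qed

section \<open>The perceptron bound\<close>

text \<open>
  The loads \<open>L t\<close> have mean \<open>t\<close>. Their variance grows by at most \<open>card C\<close> per step, because
  every customer passes its unit of load to a customer that is not more loaded; but the
  loads on \<open>T\<close> fall behind the mean by at least one per step.
\<close>

lemma perceptron_bound:
  fixes L :: "nat \<Rightarrow> 'a \<Rightarrow> nat" and h :: "nat \<Rightarrow> 'a \<Rightarrow> 'a"
  assumes C: "finite C" and T: "T \<subseteq> C"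
    and L0: "\<And>v. v \<in> C \<Longrightarrow> L 0 v = 0"
    and L_Suc: "\<And>t v. v \<in> C \<Longrightarrow> L (Suc t) v = L t v + card {q \<in> C. h t q = v}"
    and h: "\<And>t q. q \<in> C \<Longrightarrow> h t q \<in> C" "\<And>t q. q \<in> C \<Longrightarrow> L t (h t q) \<le> L t q"
    and lag: "\<And>t. t < N \<Longrightarrow> card {q \<in> C. h t q \<in> T} < card T"
  shows "N \<le> card C ^ 3"
proof -
  define n where "n = real (card C)"
  define a where "a t v = real (card {q \<in> C. h t q = v})" for t v
  \<comment> \<open>The deviation of a load from the mean \<open>t\<close>.\<close>
  define l where "l t v = real (L t v) - real t" for t v
  have fT: "finite T" using C T finite_subset by blast
  have l_Suc: "l (Suc t) v = l t v + (a t v - 1)" if "v \<in> C" for t v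
    using L_Suc[OF that, of t] by (simp add: l_def a_def)
  \<comment> \<open>Double counting: grouping the customers \<open>q\<close> by the value
    \<open>h t q\<close> weights each \<open>f v\<close> with the number of customers sent to
    \<open>v\<close>.\<close>
  have sum_a: "(\<Sum>v\<in>S. a t v * f v) = (\<Sum>q\<in>{q\<in>C. h t q \<in> S}. f (h t q))" if "finite S" for S t f
  proof -
    have "(\<Sum>q\<in>{q\<in>C. h t q \<in> S}. f (h t q)) = (\<Sum>v\<in>S. \<Sum>q\<in>{q\<in>{q\<in>C. h t q \<in> S}. h t q = v}. f (h t q))"
      by (rule sum.group[symmetric]) (use C that in auto)
    also have "\<dots> = (\<Sum>v\<in>S. a t v * f v)"
    proof (rule sum.cong[OF refl])
      fix v assume "v \<in> S"
      then have "{q\<in>{q\<in>C. h t q \<in> S}. h t q = v} = {q \<in> C. h t q = v}" by auto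
      then show "(\<Sum>q\<in>{q\<in>{q\<in>C. h t q \<in> S}. h t q = v}. f (h t q)) = a t v * f v"
        by (simp add: a_def)
    qed
    finally show ?thesis by simp
  qed
  have Ch: "{q \<in> C. h t q \<in> C} = C" for t using h(1) by auto
  have sum_a_C: "(\<Sum>v\<in>C. a t v) = n" for t
    using sum_a[OF C, of t "\<lambda>_. 1"] by (simp add: Ch n_def)
  have a_le: "a t v \<le> n" for t v
    unfolding a_def n_def using C by (auto intro!: card_mono)
  have sum_l: "(\<Sum>v\<in>C. l t v) = 0" for t
  proof (induction t)
    case 0
    then show ?case using L0 by (simp add: l_def)
  next
    case (Suc t)
    have "(\<Sum>v\<in>C. l (Suc t) v) = (\<Sum>v\<in>C. l t v) + ((\<Sum>v\<in>C. a t v) - n)"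
      by (simp add: l_Suc sum.distrib sum_subtractf n_def)
    then show ?case using Suc by (simp add: sum_a_C)
  qed
  have var: "(\<Sum>v\<in>C. (l t v)\<^sup>2) \<le> real t * n\<^sup>2" for t
  proof (induction t)
    case 0
    then show ?case using L0 by (simp add: l_def)
  next
    case (Suc t)
    \<comment> \<open>The cross term of the variance. Passing load to a customer that is not more
      loaded makes it at most the sum of all deviations, which is zero.\<close>
    have "(\<Sum>v\<in>C. a t v * l t v) = (\<Sum>q\<in>C. l t (h t q))" using sum_a[OF C, of t "l t"] by (simp add: Ch)
    also have "\<dots> \<le> (\<Sum>q\<in>C. l t q)" by (rule sum_mono) (use h in \<open>simp add: l_def\<close>)
    finally have cross: "(\<Sum>v\<in>C. a t v * l t v) \<le> 0" by (simp add: sum_l)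
    \<comment> \<open>The numbers \<open>a t v\<close> are at most \<open>n\<close> and add up to
      \<open>n\<close>.\<close>
    have "(\<Sum>v\<in>C. (a t v)\<^sup>2) \<le> (\<Sum>v\<in>C. a t v * n)"
      unfolding power2_eq_square by (intro sum_mono mult_left_mono a_le) (simp add: a_def)
    also have "\<dots> = n\<^sup>2" by (simp add: sum_distrib_right[symmetric] sum_a_C power2_eq_square)
    finally have sq: "(\<Sum>v\<in>C. (a t v)\<^sup>2) \<le> n\<^sup>2" .
    \<comment> \<open>In the expanded square the deviations cancel, and the last two terms sum to
      \<open>- n\<close>.\<close>
    have "(\<Sum>v\<in>C. (l (Suc t) v)\<^sup>2) =
        (\<Sum>v\<in>C. (l t v)\<^sup>2 + 2 * (a t v * l t v) - 2 * l t v + (a t v)\<^sup>2 - 2 * a t v + 1)"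
      by (rule sum.cong) (simp_all add: l_Suc power2_eq_square algebra_simps)
    also have "\<dots> = (\<Sum>v\<in>C. (l t v)\<^sup>2) + 2 * (\<Sum>v\<in>C. a t v * l t v) + (\<Sum>v\<in>C. (a t v)\<^sup>2) - n"
      by (simp add: sum.distrib sum_subtractf sum_distrib_left[symmetric] sum_l sum_a_C n_def)
    also have "\<dots> \<le> real t * n\<^sup>2 + n\<^sup>2" using Suc cross sq by (simp add: n_def)
    finally show ?case by (simp add: algebra_simps)
  qed
  \<comment> \<open>Cardinalities are integers, so the strict inequality \<open>lag\<close> costs
    \<open>T\<close> at least one full unit against the mean in each round.\<close>
  have "real t \<le> - (\<Sum>v\<in>T. l t v)" if "t \<le> N" for t
    using that
  proof (induction t)
    case 0
    have "(\<Sum>v\<in>T. l 0 v) = 0" by (rule sum.neutral) (use L0 T in \<open>auto simp: l_def\<close>)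
    then show ?case by simp
  next
    case (Suc t)
    have "(\<Sum>v\<in>T. a t v) = real (card {q \<in> C. h t q \<in> T})"
      using sum_a[OF fT, of t "\<lambda>_. 1"] by simp
    then have "(\<Sum>v\<in>T. a t v) \<le> real (card T) - 1" using lag[of t] Suc.prems by simp
    moreover have "(\<Sum>v\<in>T. l (Suc t) v) = (\<Sum>v\<in>T. l t v + (a t v - 1))"
      by (rule sum.cong) (use T l_Suc in auto)
    ultimately show ?case using Suc by (simp add: sum.distrib sum_subtractf)
  qed
  \<comment> \<open>Cauchy-Schwarz against the constant vector 1 on \<open>T\<close> compares the
    linear lag, squared, with a variance that is only linear in \<open>N\<close>; cancelling
    \<open>N\<close> leaves the cubic bound.\<close>
  from this[of N] have "(real N)\<^sup>2 \<le> (- (\<Sum>v\<in>T. l N v))\<^sup>2" by (intro power_mono) auto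
  also have "\<dots> = (\<Sum>v\<in>T. 1 * l N v)\<^sup>2" by simp
  also have "\<dots> \<le> (\<Sum>v\<in>T. 1\<^sup>2) * (\<Sum>v\<in>T. (l N v)\<^sup>2)" by (rule Cauchy_Schwarz_ineq_sum)
  also have "\<dots> \<le> n * (\<Sum>v\<in>C. (l N v)\<^sup>2)"
    using C T by (intro mult_mono sum_mono2) (auto simp: n_def card_mono sum_nonneg)
  also have "\<dots> \<le> n * (real N * n\<^sup>2)" by (intro mult_left_mono var) (simp add: n_def)
  finally have "real N * real N \<le> real N * n ^ 3" by (simp add: power2_eq_square power3_eq_cube algebra_simps)
  then have "N = 0 \<or> real N \<le> n ^ 3" by (cases "N = 0") auto
  then show ?thesis unfolding n_def of_nat_power[symmetric] of_nat_le_iff by auto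
qed

section \<open>From clusterings to PCM instances\<close>

text \<open>What a single round provides, stripped of lists and loads. In this locale
  \<open>\<rho>\<close> is the radius and not the violation factor.\<close>

locale clustering =
  fixes F C :: "nat set" and d :: "nat \<Rightarrow> nat \<Rightarrow> real" and \<rho> :: real
    and R :: "nat set" and h :: "nat \<Rightarrow> nat"
  assumes finite_F: "finite F" and finite_C: "finite C" and metric: "Metric_space (F \<union> C) d"
    and R_sub: "R \<subseteq> C" and h_R: "q \<in> C \<Longrightarrow> h q \<in> R"
    and h_near: "q \<in> C \<Longrightarrow> d (h q) q \<le> 2 * \<rho>"
    and R_sep: "u \<in> R \<Longrightarrow> v \<in> R \<Longrightarrow> d u v \<le> 2 * \<rho> \<Longrightarrow> u = v"
begin

interpretation Metric_space "F \<union> C" d by (rule metric)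

definition ball_of :: "nat \<Rightarrow> nat set" where
  "ball_of v = {f \<in> F. d v f \<le> \<rho>}"

definition parts :: "nat set set" where
  "parts = {A. A \<noteq> {} \<and> (\<exists>v\<in>R. A = ball_of v)}"

definition weight :: "nat \<Rightarrow> nat" where
  "weight f = card {q \<in> C. d (h q) f \<le> \<rho>}"

lemma ball_of_disjoint:
  assumes "u \<in> R" "v \<in> R" "f \<in> ball_of u" "f \<in> ball_of v"
  shows "u = v"
proof (rule R_sep[OF assms(1,2)])
  have "d u v \<le> d u f + d f v"
    using assms R_sub by (intro triangle) (auto simp: ball_of_def)
  then show "d u v \<le> 2 * \<rho>" using assms(3,4) commute[of f v] by (auto simp: ball_of_def)
qed

text \<open>Heads are more than two radii apart, so the balls are disjoint. A facility in the ball
  of \<open>v\<close> is therefore near no other head, and its weight is the number of customers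
  with head \<open>v\<close>, the same throughout the ball.\<close>

lemma pcm_instance_parts:
  assumes "down_closed F \<F>"
  shows "pcm_instance F \<F> parts weight"
  unfolding pcm_instance_def
proof (intro conjI ballI)
  show "partition_on (\<Union>parts) parts"
    by (intro partition_onI) (use ball_of_disjoint in \<open>auto simp: parts_def disjnt_def\<close>)
  fix A f g assume A: "A \<in> parts" "f \<in> A" "g \<in> A"
  then obtain v where v: "v \<in> R" "A = ball_of v" by (auto simp: parts_def)
  have "{q \<in> C. d (h q) f \<le> \<rho>} = {q \<in> C. h q = v}" if "f \<in> ball_of v" for f
    using that h_R ball_of_disjoint[OF _ v(1), of _ f] by (auto simp: ball_of_def)
  then show "weight f = weight g" using A v by (simp add: weight_def)
qed (use finite_F assms in \<open>auto simp: parts_def ball_of_def\<close>)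

text \<open>With at most one facility chosen in each ball, no customer is counted twice: two
  facilities counting it would both lie in the ball of its head.\<close>

lemma sum_weight:
  assumes S: "S \<subseteq> F" "\<forall>A\<in>parts. card (S \<inter> A) \<le> 1"
  shows "sum weight S = card {q \<in> C. \<exists>f\<in>S. d (h q) f \<le> \<rho>}"
proof -
  have fS: "finite S" using S(1) finite_F finite_subset by blast
  have "f = g" if fg: "f \<in> S" "g \<in> S" "q \<in> C" "d (h q) f \<le> \<rho>" "d (h q) g \<le> \<rho>" for f g q
  proof -
    have "f \<in> ball_of (h q)" "g \<in> ball_of (h q)" using fg S(1) by (auto simp: ball_of_def)
    then have "card (S \<inter> ball_of (h q)) \<le> 1" using S(2) h_R fg(3) by (auto simp: parts_def)
    then show ?thesis
      using \<open>f \<in> ball_of (h q)\<close> \<open>g \<in> ball_of (h q)\<close> fg fS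
      by (auto simp: card_le_Suc0_iff_eq)
  qed
  then have "card (\<Union>f\<in>S. {q \<in> C. d (h q) f \<le> \<rho>}) = sum weight S"
    unfolding weight_def using fS finite_C by (intro card_UN_disjoint) auto
  moreover have "(\<Union>f\<in>S. {q \<in> C. d (h q) f \<le> \<rho>}) = {q \<in> C. \<exists>f\<in>S. d (h q) f \<le> \<rho>}" by auto
  ultimately show ?thesis by simp
qed

text \<open>The source of the factor 3: two radii from a customer to its head and one from the head
  to the facility.\<close>

lemma sum_weight_le_covered:
  assumes S: "S \<subseteq> F" "\<forall>A\<in>parts. card (S \<inter> A) \<le> 1"
  shows "sum weight S \<le> card {q \<in> C. \<exists>f\<in>S. d q f \<le> 3 * \<rho>}"
  unfolding sum_weight[OF S]
proof (rule card_mono)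
  show "{q \<in> C. \<exists>f\<in>S. d (h q) f \<le> \<rho>} \<subseteq> {q \<in> C. \<exists>f\<in>S. d q f \<le> 3 * \<rho>}"
  proof clarify
    fix q f assume qf: "q \<in> C" "f \<in> S" "d (h q) f \<le> \<rho>"
    have "d q f \<le> d q (h q) + d (h q) f"
      using qf h_R R_sub S(1) by (intro triangle) auto
    then have "d q f \<le> 3 * \<rho>" using h_near[OF qf(1)] qf(3) commute[of q "h q"] by simp
    then show "\<exists>f\<in>S. d q f \<le> 3 * \<rho>" using qf(2) by blast
  qed
qed (use finite_C in simp)

text \<open>Each head in \<open>T\<close> picks one facility of \<open>S\<close> within the radius.
  The chosen facilities form a subset of \<open>S\<close>, hence a feasible set, and meet every ball
  at most once, so they are a PCM solution that counts every customer whose head is in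
  \<open>T\<close>.\<close>

lemma covered_le_pcm_opt:
  assumes \<F>: "down_closed F \<F>" and S: "S \<in> \<F>"
    and T: "\<And>u. u \<in> T \<Longrightarrow> \<exists>f\<in>S. d u f \<le> \<rho>"
  shows "card {q \<in> C. h q \<in> T} \<le> pcm_opt \<F> parts weight"
proof -
  obtain g where g: "\<And>u. u \<in> T \<Longrightarrow> g u \<in> S \<and> d u (g u) \<le> \<rho>" using T by metis
  let ?S = "g ` (T \<inter> R)"
  have sub: "?S \<subseteq> S" using g by auto
  then have S': "?S \<in> \<F>" "?S \<subseteq> F" using \<F> S by (auto simp: down_closed_def)
  have one: "\<forall>A\<in>parts. card (?S \<inter> A) \<le> 1"
  proof
    fix A assume "A \<in> parts"
    then obtain v where v: "v \<in> R" "A = ball_of v" by (auto simp: parts_def)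
    have "?S \<inter> A \<subseteq> {g v}"
    proof clarify
      fix u assume u: "u \<in> T" "u \<in> R" "g u \<in> A"
      then have "g u \<in> ball_of u" using g S'(2) by (auto simp: ball_of_def)
      then show "g u = g v" using ball_of_disjoint[of u v "g u"] u v by auto
    qed
    then show "card (?S \<inter> A) \<le> 1" using card_mono[of "{g v}" "?S \<inter> A"] by simp
  qed
  have "card {q \<in> C. h q \<in> T} \<le> card {q \<in> C. \<exists>f\<in>?S. d (h q) f \<le> \<rho>}"
    using finite_C g h_R by (intro card_mono) auto
  also have "\<dots> = sum weight ?S" by (rule sum_weight[OF S'(2) one, symmetric])
  also have "\<dots> \<le> pcm_opt \<F> parts weight"
    unfolding pcm_opt_def
  proof (rule Max_ge)
    have "finite \<F>" using \<F> finite_F by (auto simp: down_closed_def intro: finite_subset)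
    then show "finite {sum weight S | S. S \<in> \<F> \<and> (\<forall>A\<in>parts. card (S \<inter> A) \<le> 1)}" by simp
  qed (use S' one in blast)
  finally show ?thesis .
qed

end

section \<open>Correctness of the algorithm\<close>

text \<open>Induction along the load order. An accepted customer is near itself; a rejected one has
  a near head chosen earlier, which is not more loaded because of the sorting.\<close>

lemma reps_properties:
  assumes refl: "\<And>p. p \<in> set ps \<Longrightarrow> near 2 es r (snd p) (snd p)"
  shows set_reps: "set (reps es r ps) \<subseteq> set ps"
    and reps_cover: "p \<in> set ps \<Longrightarrow>
      \<exists>q\<in>set (reps es r ps). near 2 es r (snd q) (snd p) \<and> fst q \<le> fst p"
    and reps_separated: "sorted_wrt (\<lambda>p q. \<not> near 2 es r (snd q) (snd p)) (reps es r ps)"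
proof -
  let ?f = "\<lambda>p R. if filter (\<lambda>q. near 2 es r (snd q) (snd p)) R \<noteq> [] then R else p # R"
  have "set (fold ?f qs []) \<subseteq> set qs \<and>
      (\<forall>p\<in>set qs. \<exists>q\<in>set (fold ?f qs []). near 2 es r (snd q) (snd p) \<and> fst q \<le> fst p) \<and>
      sorted_wrt (\<lambda>p q. \<not> near 2 es r (snd q) (snd p)) (fold ?f qs [])"
    if "set qs \<subseteq> set ps" "sorted (map fst qs)" for qs
    using that
  proof (induction qs rule: rev_induct)
    case (snoc p qs)
    let ?R = "fold ?f qs []"
    have IH: "set ?R \<subseteq> set qs"
        "\<forall>p\<in>set qs. \<exists>q\<in>set ?R. near 2 es r (snd q) (snd p) \<and> fst q \<le> fst p"
        "sorted_wrt (\<lambda>p q. \<not> near 2 es r (snd q) (snd p)) ?R"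
      using snoc by (auto simp: sorted_append)
    have le: "\<forall>q\<in>set qs. fst q \<le> fst p" using snoc.prems(2) by (auto simp: sorted_append)
    have p: "near 2 es r (snd p) (snd p)" using snoc.prems(1) refl by auto
    show ?case
    proof (cases "filter (\<lambda>q. near 2 es r (snd q) (snd p)) ?R = []")
      case True
      then have "fold ?f (qs @ [p]) [] = p # ?R" by simp
      moreover have "\<forall>q\<in>set ?R. \<not> near 2 es r (snd q) (snd p)"
        using True by (simp add: filter_empty_conv)
      ultimately show ?thesis using IH p by auto
    next
      case False
      then have eq: "fold ?f (qs @ [p]) [] = ?R" by simp
      obtain q where "q \<in> set ?R" "near 2 es r (snd q) (snd p)"
        using False by (auto simp: filter_empty_conv)
      then show ?thesis using IH le unfolding eq by auto
    qed
  qed simp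
  from this[of "sort_load ps"]
  show "set (reps es r ps) \<subseteq> set ps"
    and "p \<in> set ps \<Longrightarrow>
      \<exists>q\<in>set (reps es r ps). near 2 es r (snd q) (snd p) \<and> fst q \<le> fst p"
    and "sorted_wrt (\<lambda>p q. \<not> near 2 es r (snd q) (snd p)) (reps es r ps)"
    using sorted_sort_load[of ps] by (auto simp: set_sort_load reps_def)
qed

lemma rep_properties:
  assumes "\<exists>q\<in>set R. near 2 es r (snd q) (snd p) \<and> fst q \<le> fst p"
  shows "rep es r R p \<in> set R \<and> near 2 es r (snd (rep es r R p)) (snd p) \<and> fst (rep es r R p) \<le> fst p"
proof -
  let ?f = "\<lambda>q acc. if near 2 es r (snd q) (snd p) \<and> fst q \<le> fst acc then q else acc"
  \<comment> \<open>The load of the accumulator never increases, and once the accumulator is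
    replaced it remains a near head.\<close>
  have le: "fst (fold ?f R acc) \<le> fst acc \<and>
      (fold ?f R acc = acc \<or> fold ?f R acc \<in> set R \<and> near 2 es r (snd (fold ?f R acc)) (snd p))"
    for R and acc :: "nat \<times> nat"
  proof (induction R arbitrary: acc)
    case (Cons q R)
    show ?case
    proof (cases "near 2 es r (snd q) (snd p) \<and> fst q \<le> fst acc")
      case True
      then show ?thesis using Cons[of q] order_trans[of _ "fst q" "fst acc"] by auto
    next
      case False
      then show ?thesis using Cons[of acc] by auto
    qed
  qed simp
  have "fold ?f R acc \<in> set R \<and> near 2 es r (snd (fold ?f R acc)) (snd p)"
    if "\<exists>q\<in>set R. near 2 es r (snd q) (snd p) \<and> fst q \<le> fst acc" for acc
    using that
  proof (induction R arbitrary: acc)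
    case (Cons q R)
    show ?case
    proof (cases "near 2 es r (snd q) (snd p) \<and> fst q \<le> fst acc")
      case True
      then show ?thesis using le[of R q] by auto
    next
      case False
      then show ?thesis using Cons.IH[of acc] Cons.prems by auto
    qed
  qed simp
  from this[OF assms] le[of R p] show ?thesis unfolding rep_def by auto
qed

section \<open>Distance tests and loads as functions\<close>

definition metric_entries :: "nat set \<Rightarrow> (nat \<Rightarrow> nat \<Rightarrow> real) \<Rightarrow> entry list \<Rightarrow> bool" where
  "metric_entries X d es \<longleftrightarrow>
     (\<exists>a b. (\<forall>x\<in>X. \<forall>y\<in>X. 0 < b x y \<and> d x y = real (a x y) / real (b x y)) \<and>
       set es = {(x, y, a x y, b x y, 0) | x y. x \<in> X \<and> y \<in> X})"

text \<open>The program compares fractions by cross multiplication, which is sound as both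
  denominators are positive. For points of \<open>X\<close> exactly one entry of the list
  matches.\<close>

lemma near_iff:
  assumes es: "metric_entries X d es" and xy: "x \<in> X" "y \<in> X" and q: "0 < q"
  shows "near k es (p, q) x y \<longleftrightarrow> d x y \<le> real k * (real p / real q)"
proof -
  obtain a b where ab: "\<forall>x\<in>X. \<forall>y\<in>X. 0 < b x y \<and> d x y = real (a x y) / real (b x y)"
      "set es = {(x, y, a x y, b x y, 0) | x y. x \<in> X \<and> y \<in> X}"
    using es unfolding metric_entries_def by blast
  have "near k es (p, q) x y \<longleftrightarrow> a x y * q \<le> k * p * b x y"
    unfolding near_def filter_empty_conv ab(2) using xy by auto
  also have "\<dots> \<longleftrightarrow> real (a x y) * real q \<le> real k * real p * real (b x y)"
    unfolding of_nat_mult[symmetric] of_nat_le_iff ..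
  also have "\<dots> \<longleftrightarrow> d x y \<le> real k * (real p / real q)"
    using ab(1) xy q by (simp add: field_simps)
  finally show ?thesis .
qed

definition loaded :: "(nat \<Rightarrow> nat) \<Rightarrow> nat list \<Rightarrow> (nat \<times> nat) list" where
  "loaded L cs = map (\<lambda>c. (L c, c)) cs"

definition head :: "entry list \<Rightarrow> nat \<times> nat \<Rightarrow> nat list \<Rightarrow> (nat \<Rightarrow> nat) \<Rightarrow> nat \<Rightarrow> nat" where
  "head es r cs L q = snd (rep es r (reps es r (loaded L cs)) (L q, q))"

abbreviation heads :: "entry list \<Rightarrow> nat \<times> nat \<Rightarrow> nat list \<Rightarrow> (nat \<Rightarrow> nat) \<Rightarrow> nat set" where
  "heads es r cs L \<equiv> snd ` set (reps es r (loaded L cs))"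

text \<open>The same iteration as \<open>add_loads\<close>, expressed by functions on customers as
  \<open>perceptron_bound\<close> requires.\<close>

primrec load :: "entry list \<Rightarrow> nat \<times> nat \<Rightarrow> nat list \<Rightarrow> nat \<Rightarrow> nat \<Rightarrow> nat" where
  "load es r cs 0 = (\<lambda>_. 0)"
| "load es r cs (Suc t) =
     (\<lambda>v. load es r cs t v + card {q \<in> set cs. head es r cs (load es r cs t) q = v})"

lemma length_filter_distinct:
  "distinct xs \<Longrightarrow> length (filter P xs) = card {x \<in> set xs. P x}"
  using distinct_card[of "filter P xs"] by simp

lemma add_loads_loaded:
  assumes "distinct cs"
  shows "add_loads es r (loaded L cs) =
    loaded (\<lambda>v. L v + card {q \<in> set cs. head es r cs L q = v}) cs"
  unfolding add_loads_def
  by (simp add: loaded_def filter_map comp_def length_filter_distinct[OF assms] head_def)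

lemma set_loads_trace:
  assumes "distinct cs"
  shows "set (loads_trace es r cs) = (\<lambda>t. loaded (load es r cs t) cs) ` {..<length cs ^ 3 + 1}"
proof -
  have "fold (\<lambda>_. loads_step es r) ys (map (\<lambda>c. (0, c)) cs, []) =
      (loaded (load es r cs (length ys)) cs, rev (map (\<lambda>t. loaded (load es r cs t) cs) [0..<length ys]))"
    for ys :: "nat list"
    by (induction ys rule: rev_induct)
      (simp_all add: loads_step_def add_loads_loaded[OF assms] loaded_def[of "\<lambda>_. 0"])
  then show ?thesis
    by (simp add: loads_trace_def length_ticks image_set[symmetric] atLeast0LessThan
        del: upt_Suc image_set)
qed

text \<open>A minimum of fractions under cross multiplication. The start value \<open>1 / 0\<close>
  acts as infinity, so the first element with a positive denominator replaces it.\<close>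

lemma fold_best:
  fixes num den :: "'a \<Rightarrow> nat"
  assumes init: "num init = 1" "den init = 0" and den: "\<And>s. s \<in> set xs \<Longrightarrow> 0 < den s"
  defines "f \<equiv> \<lambda>s acc. if num s * den acc < num acc * den s then s else acc"
  shows "fold f xs init = init \<and> xs = [] \<or>
    fold f xs init \<in> set xs \<and> (\<forall>s\<in>set xs. num (fold f xs init) * den s \<le> num s * den (fold f xs init))"
  using den
proof (induction xs rule: rev_induct)
  case (snoc s xs)
  let ?acc = "fold f xs init"
  have fold: "fold f (xs @ [s]) init = (if num s * den ?acc < num ?acc * den s then s else ?acc)"
    by (simp add: f_def)
  have s: "0 < den s" using snoc.prems by simp
  show ?case
  proof (cases "xs = []")
    case True
    then show ?thesis using s init by (simp add: f_def)
  next
    case False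
    then have acc: "?acc \<in> set xs" "\<forall>s'\<in>set xs. num ?acc * den s' \<le> num s' * den ?acc"
      using snoc by auto
    show ?thesis
    proof (cases "num s * den ?acc < num ?acc * den s")
      case True
      have "num s * den s' \<le> num s' * den s" if "s' \<in> set xs" for s'
      proof -
        \<comment> \<open>Transitivity of the comparison: both sides are multiplied by the
          denominator of the old minimum, which is positive and is cancelled at the end.\<close>
        have "(num s * den ?acc) * den s' \<le> (num ?acc * den s) * den s'"
          using True by (intro mult_right_mono) auto
        also have "\<dots> = (num ?acc * den s') * den s" by (simp add: mult_ac)
        also have "\<dots> \<le> (num s' * den ?acc) * den s" using acc(2) that by (intro mult_right_mono) auto
        finally have "(num s * den s') * den ?acc \<le> (num s' * den s) * den ?acc"
          by (simp add: mult_ac)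
        then show ?thesis using snoc.prems[of ?acc] acc(1) by simp
      qed
      then show ?thesis unfolding fold using True by auto
    next
      case False
      then show ?thesis unfolding fold using acc by auto
    qed
  qed
qed simp

section \<open>A round of the algorithm as a clustering\<close>

locale supplier_data =
  fixes F C :: "nat set" and d :: "nat \<Rightarrow> nat \<Rightarrow> real"
    and fs cs :: "nat list" and es :: "entry list"
  assumes fs: "enumerates fs F" and cs: "enumerates cs C"
    and metric: "Metric_space (F \<union> C) d" and entries: "metric_entries (F \<union> C) d es"
begin

interpretation Metric_space "F \<union> C" d by (rule metric)

lemma set_cs: "set cs = C" "distinct cs" and set_fs: "set fs = F" "distinct fs"
  using fs cs by (auto simp: enumerates_def)

context
  fixes L :: "nat \<Rightarrow> nat" and p q :: nat
  assumes q: "0 < q"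
begin

lemma near_refl: "u \<in> C \<Longrightarrow> near 2 es (p, q) u u"
  by (simp add: near_iff[OF entries _ _ q])

lemma reps_loaded:
  shows heads_subset: "heads es (p, q) cs L \<subseteq> C"
    and reps_pair: "z \<in> set (reps es (p, q) (loaded L cs)) \<Longrightarrow> z = (L (snd z), snd z)"
    and head_in: "u \<in> C \<Longrightarrow> head es (p, q) cs L u \<in> heads es (p, q) cs L"
    and head_near: "u \<in> C \<Longrightarrow> near 2 es (p, q) (head es (p, q) cs L u) u"
    and head_le: "u \<in> C \<Longrightarrow> L (head es (p, q) cs L u) \<le> L u"
    and heads_sep: "sorted_wrt (\<lambda>u v. \<not> near 2 es (p, q) v u) (map snd (reps es (p, q) (loaded L cs)))"
proof -
  have refl: "near 2 es (p, q) (snd z) (snd z)" if "z \<in> set (loaded L cs)" for z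
    using that near_refl by (auto simp: loaded_def set_cs)
  note set = set_reps[of "loaded L cs" es "(p, q)", OF refl]
  show "heads es (p, q) cs L \<subseteq> C" using set by (auto simp: loaded_def set_cs)
  show pair: "z \<in> set (reps es (p, q) (loaded L cs)) \<Longrightarrow> z = (L (snd z), snd z)" for z
    using set by (auto simp: loaded_def)
  show "sorted_wrt (\<lambda>u v. \<not> near 2 es (p, q) v u) (map snd (reps es (p, q) (loaded L cs)))"
    using reps_separated[of "loaded L cs" es "(p, q)", OF refl] by (simp add: sorted_wrt_map)
  assume "u \<in> C"
  then have "(L u, u) \<in> set (loaded L cs)" by (simp add: loaded_def set_cs)
  from rep_properties[OF reps_cover[of "loaded L cs" es "(p, q)", OF refl this]]
  have rep: "rep es (p, q) (reps es (p, q) (loaded L cs)) (L u, u) \<in> set (reps es (p, q) (loaded L cs))"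
    "near 2 es (p, q) (head es (p, q) cs L u) u"
    "fst (rep es (p, q) (reps es (p, q) (loaded L cs)) (L u, u)) \<le> L u"
    by (auto simp: head_def)
  then show "head es (p, q) cs L u \<in> heads es (p, q) cs L" "near 2 es (p, q) (head es (p, q) cs L u) u"
    by (auto simp: head_def)
  show "L (head es (p, q) cs L u) \<le> L u"
    using rep(3) pair[OF rep(1)] unfolding head_def by (metis fst_conv)
qed

lemma clustering_heads:
  "clustering F C d (real p / real q) (heads es (p, q) cs L) (head es (p, q) cs L)"
proof (rule clustering.intro)
  show "finite F" "finite C" using set_cs set_fs by auto
  show "Metric_space (F \<union> C) d" by (rule metric)
  show sub: "heads es (p, q) cs L \<subseteq> C" by (rule heads_subset)
  fix u assume u: "u \<in> C"
  show "head es (p, q) cs L u \<in> heads es (p, q) cs L" by (rule head_in[OF u])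
  then show "d (head es (p, q) cs L u) u \<le> 2 * (real p / real q)"
    using head_near[OF u] sub u by (subst (asm) near_iff[OF entries _ _ q]) auto
next
  fix u v assume uv: "u \<in> heads es (p, q) cs L" "v \<in> heads es (p, q) cs L"
    "d u v \<le> 2 * (real p / real q)"
  then have near: "near 2 es (p, q) u v" "near 2 es (p, q) v u"
    using heads_subset commute[of u v] by (auto simp: near_iff[OF entries _ _ q] subset_iff)
  \<comment> \<open>The list separates its members in one order only; since \<open>u\<close> and
    \<open>v\<close> are near in both orders, their positions do not matter.\<close>
  have "u = v" if "sorted_wrt (\<lambda>u v. \<not> near 2 es (p, q) v u) xs" "u \<in> set xs" "v \<in> set xs" for xs
    using that near by (induction xs) auto
  from this[OF heads_sep] show "u = v" using uv(1,2) by simp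
qed

text \<open>A repeated head would be near itself, contrary to the separation.\<close>

lemma distinct_heads: "distinct (map snd (reps es (p, q) (loaded L cs)))"
proof -
  have "distinct xs" if "sorted_wrt (\<lambda>u v. \<not> near 2 es (p, q) v u) xs" "set xs \<subseteq> C" for xs
    using that by (induction xs) (use near_refl in auto)
  then show ?thesis using heads_sep heads_subset by simp
qed

interpretation clustering F C d "real p / real q" "heads es (p, q) cs L" "head es (p, q) cs L"
  by (rule clustering_heads)

lemma pcm_code_pcm_of:
  assumes \<delta>: "\<delta> \<in> descriptions K F" "down_closed F (family K F \<delta>)"
  shows "pcm_code K F \<delta> parts weight (enc (pcm_of fs \<delta> es (p, q) (loaded L cs)))"
proof -
  let ?R = "reps es (p, q) (loaded L cs)"
  let ?B = "\<lambda>v. filter (\<lambda>f. near 1 es (p, q) v f) fs"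
  let ?parts = "filter (\<lambda>b. b \<noteq> []) (map (\<lambda>z. ?B (snd z)) ?R)"
  have B: "set (?B v) = ball_of v" if "v \<in> heads es (p, q) cs L" for v
    using that heads_subset near_iff[OF entries _ _ q, of v _ 1 p]
    by (auto simp: set_fs ball_of_def subset_iff)
  have sets: "sets_code parts (enc ?parts)"
    unfolding sets_code_def
  proof (intro exI conjI)
    show "\<forall>xs\<in>set ?parts. distinct xs" using set_fs(2) by auto
    have "distinct (map set (filter (\<lambda>b. b \<noteq> []) (map ?B vs)))"
      if "distinct vs" "set vs \<subseteq> heads es (p, q) cs L" for vs
      using that
    proof (induction vs)
      case (Cons v vs)
      \<comment> \<open>Disjoint balls of different heads can only coincide when empty, and empty
        balls have been filtered out.\<close>
      have "set (?B v) \<noteq> set (?B u)" if u: "u \<in> set vs" "?B v \<noteq> []" for u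
      proof
        assume eq: "set (?B v) = set (?B u)"
        obtain f where f: "f \<in> set (?B v)" using u(2) by (meson list.set_sel(1))
        have heads: "v \<in> heads es (p, q) cs L" "u \<in> heads es (p, q) cs L"
          using Cons.prems u(1) by auto
        have "f \<in> ball_of v" "f \<in> ball_of u" using f eq unfolding B[OF heads(1)] B[OF heads(2)] by blast+
        then have "v = u" using ball_of_disjoint heads by blast
        then show False using Cons.prems u(1) by simp
      qed
      then show ?case using Cons by auto
    qed simp
    from this[OF distinct_heads] show "distinct (map set ?parts)" by (simp add: comp_def)
    show "set (map set ?parts) = parts"
    proof (intro equalityI subsetI)
      fix A assume "A \<in> set (map set ?parts)"
      then obtain z where z: "z \<in> set ?R" "?B (snd z) \<noteq> []" "A = set (?B (snd z))" by auto
      then show "A \<in> parts" using B[of "snd z"] by (auto simp: parts_def)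
    next
      fix A assume "A \<in> parts"
      then obtain z where z: "z \<in> set ?R" "A \<noteq> {}" "A = ball_of (snd z)" by (auto simp: parts_def)
      then have A: "A = set (?B (snd z))" using B[of "snd z"] by simp
      then have "?B (snd z) \<noteq> []" using z(2) by (metis list.set(1))
      then have "?B (snd z) \<in> set ?parts" using z(1) by simp
      then show "A \<in> set (map set ?parts)" unfolding A set_map by (rule imageI)
    qed
    show "enc ?parts = list_code (map nats_code ?parts)"
      by (simp add: enc_list_def nats_code_def enc_nat_def[abs_def] cong: map_cong)
  qed
  have weight: "length (filter (\<lambda>z. near 1 es (p, q) (snd (rep es (p, q) ?R z)) f) (loaded L cs)) = weight f"
    if "f \<in> F" for f
  proof -
    have "near 1 es (p, q) (head es (p, q) cs L u) f \<longleftrightarrow> d (head es (p, q) cs L u) f \<le> real p / real q"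
      if "u \<in> C" for u
      using near_iff[OF entries _ _ q, of "head es (p, q) cs L u" f 1 p] head_in[OF that] heads_subset \<open>f \<in> F\<close>
      by auto
    then have "{u \<in> C. near 1 es (p, q) (head es (p, q) cs L u) f} =
      {u \<in> C. d (head es (p, q) cs L u) f \<le> real p / real q}" by auto
    then show ?thesis
      by (simp add: loaded_def filter_map comp_def length_filter_distinct[OF set_cs(2)] weight_def
          head_def set_cs(1))
  qed
  let ?val = "\<lambda>f. (f, map (\<lambda>_. 0::nat)
    (filter (\<lambda>z. near 1 es (p, q) (snd (rep es (p, q) ?R z)) f) (loaded L cs)))"
  have "enc (?val f) = Node (Leaf f) (unary (weight f))" if "f \<in> set fs" for f
  proof -
    have "enc (replicate n (0::nat)) = unary n" for n
      by (simp add: enc_list_def unary_def enc_nat_def)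
    then show ?thesis
      unfolding enc_prod.simps map_replicate_const using weight[of f] that by (simp add: enc_nat_def set_fs(1))
  qed
  then have enc_val: "map enc (map ?val fs) = map (\<lambda>f. Node (Leaf f) (unary (weight f))) fs"
    unfolding map_map comp_def by (rule map_cong[OF refl])
  have vals: "values_code F weight (enc (map ?val fs))"
    unfolding values_code_def enc_list_def[of "map ?val fs"] enc_val using fs by blast
  have "pcm_instance F (family K F \<delta>) parts weight" by (rule pcm_instance_parts[OF \<delta>(2)])
  moreover have "set_code F (enc fs)"
    unfolding set_code_def using fs by (auto simp: nats_code_def enc_list_def enc_nat_def[abs_def])
  ultimately show ?thesis
    unfolding pcm_code_def pcm_of_def using \<delta>(1) sets vals
    by (auto simp: list_code_def enc_nat_def enc_data_def)
qed

end

text \<open>From here on \<open>\<rho>\<close> is the violation factor. The function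
  \<open>alg\<close> stands for the PCM algorithm and is constrained only on codes of PCM
  instances.\<close>

context
  fixes K :: family_class and \<delta> :: data and \<rho> :: real and m :: nat
    and alg :: "pcm_input \<Rightarrow> nat list"
  assumes \<delta>: "\<delta> \<in> descriptions K F" and down: "down_closed F (family K F \<delta>)"
    and relax: "relaxation K \<rho> F \<delta> \<subseteq> Pow F"
    and alg: "\<And>P val i. pcm_code K F \<delta> P val (enc i) \<Longrightarrow>
      \<exists>S. enumerates (alg i) S \<and> S \<in> relaxation K \<rho> F \<delta> \<and> (\<forall>A\<in>P. card (S \<inter> A) \<le> 1) \<and>
        pcm_opt (family K F \<delta>) P val \<le> sum val S"
begin

abbreviation input :: supplier_input where
  "input \<equiv> (fs, cs, es, m, \<delta>, 0)"

definition covered :: "nat set \<Rightarrow> real \<Rightarrow> nat set" where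
  "covered S r = {u \<in> C. \<exists>f\<in>S. d u f \<le> 3 * r}"

lemma subproblemsE:
  assumes "i \<in> set (subproblems input)"
  obtains p q L where "0 < q" "i = (pcm_of fs \<delta> es (p, q) (loaded L cs), p, q)"
proof -
  obtain e ps where e: "e \<in> set es"
      "ps \<in> set (loads_trace es (fst (snd (snd e)), fst (snd (snd (snd e)))) cs)"
      "i = (pcm_of fs \<delta> es (fst (snd (snd e)), fst (snd (snd (snd e)))) ps,
        fst (snd (snd e)), fst (snd (snd (snd e))))"
    using assms by (auto simp: subproblems_def Let_def)
  moreover have "0 < fst (snd (snd (snd e)))"
    using e(1) entries by (auto simp: metric_entries_def)
  ultimately show thesis using that unfolding set_loads_trace[OF set_cs(2)] by auto
qed

lemma subproblemsI:
  assumes "u \<in> F \<union> C" "v \<in> F \<union> C"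
  obtains p q where "0 < q" "d u v = real p / real q"
    and "\<And>t. t < card C ^ 3 + 1 \<Longrightarrow>
      (pcm_of fs \<delta> es (p, q) (loaded (load es (p, q) cs t) cs), p, q) \<in> set (subproblems input)"
proof -
  obtain a b where ab: "0 < b u v" "d u v = real (a u v) / real (b u v)"
      "(u, v, a u v, b u v, 0) \<in> set es"
    using entries assms unfolding metric_entries_def by blast
  show thesis
  proof (rule that[OF ab(1,2)])
    fix t assume "t < card C ^ 3 + 1"
    then have "loaded (load es (a u v, b u v) cs t) cs \<in> set (loads_trace es (a u v, b u v) cs)"
      using set_loads_trace[OF set_cs(2)] distinct_card[OF set_cs(2)] set_cs(1) by auto
    then show "(pcm_of fs \<delta> es (a u v, b u v) (loaded (load es (a u v, b u v) cs t) cs), a u v, b u v)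
        \<in> set (subproblems input)"
      using ab(3) by (auto simp: subproblems_def Let_def image_iff intro!: bexI[OF _ ab(3)])
  qed
qed

lemma pcm_code_fallback:
  "pcm_code K F \<delta> {} (\<lambda>_. 0) (enc (fallback input))"
proof -
  have "pcm_instance F (family K F \<delta>) {} (\<lambda>_. 0)"
    using down set_fs by (auto simp: pcm_instance_def partition_on_def)
  moreover have "set_code F (enc fs)"
    unfolding set_code_def using fs by (auto simp: nats_code_def enc_list_def enc_nat_def[abs_def])
  moreover have "sets_code {} (Leaf 0)"
    unfolding sets_code_def by (rule exI[of _ "[]"]) (simp add: list_code_def)
  moreover have "values_code F (\<lambda>_. 0) (enc (map (\<lambda>f. (f, [] :: nat list)) fs))"
    unfolding values_code_def
    by (rule exI[of _ fs]) (simp add: fs enc_list_def[of "map _ fs"] enc_nat_def unary_def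
        list_code_def[of "[]"] comp_def)
  ultimately show ?thesis
    unfolding pcm_code_def fallback_def using \<delta>
    by (auto simp: list_code_def enc_nat_def enc_data_def)
qed

lemma pcm_code_subproblem:
  "i \<in> set (subproblems input) \<Longrightarrow> \<exists>P val. pcm_code K F \<delta> P val (enc (fst i))"
proof (erule subproblemsE)
  fix p q L assume q: "0 < q" and i: "i = (pcm_of fs \<delta> es (p, q) (loaded L cs), p, q)"
  show ?thesis using pcm_code_pcm_of[OF q \<delta> down, of p L] unfolding i fst_conv by blast
qed

lemma alg_relaxation:
  "pcm_code K F \<delta> P val (enc i) \<Longrightarrow> enumerates (alg i) (set (alg i)) \<and> set (alg i) \<in> relaxation K \<rho> F \<delta>"
  using alg[of P val i] by (auto simp: enumerates_def)

lemma set_candidates: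
  "s \<in> set (candidates alg input) \<longleftrightarrow>
    (\<exists>i p q. i \<in> set (subproblems input) \<and> snd i = (p, q) \<and> s = (alg (fst i), p, q) \<and>
      m \<le> card (covered (set (alg (fst i))) (real p / real q)))"
proof -
  have len: "length (filter (\<lambda>u. filter (\<lambda>f. near 3 es (snd i) u f) (alg (fst i)) \<noteq> []) cs) =
      card (covered (set (alg (fst i))) (real p / real q))"
    if i: "i \<in> set (subproblems input)" "snd i = (p, q)" for i p q
  proof -
    have q: "0 < q" using i by (auto elim: subproblemsE)
    \<comment> \<open>The output must consist of facilities, since \<open>near\<close> is meaningful
      only for points listed in the metric.\<close>
    have "set (alg (fst i)) \<subseteq> F"
      using pcm_code_subproblem[OF i(1)] alg_relaxation relax by blast
    then have "{u \<in> C. filter (\<lambda>f. near 3 es (snd i) u f) (alg (fst i)) \<noteq> []} =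
        covered (set (alg (fst i))) (real p / real q)"
      using near_iff[OF entries _ _ q, of _ _ 3 p]
      by (auto simp: covered_def filter_empty_conv i(2) subset_iff)
    then show ?thesis by (simp add: length_filter_distinct[OF set_cs(2)] set_cs(1))
  qed
  show ?thesis
  proof
    assume "s \<in> set (candidates alg input)"
    then obtain i where i: "i \<in> set (subproblems input)" "s = (alg (fst i), snd i)"
        "m \<le> length (filter (\<lambda>u. filter (\<lambda>f. near 3 es (snd i) u f) (alg (fst i)) \<noteq> []) cs)"
      by (auto simp: candidates_def Let_def)
    then show "\<exists>i p q. i \<in> set (subproblems input) \<and> snd i = (p, q) \<and> s = (alg (fst i), p, q) \<and>
        m \<le> card (covered (set (alg (fst i))) (real p / real q))"
      using len[OF i(1), of "fst (snd i)" "snd (snd i)"]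
      by (intro exI[of _ i] exI[of _ "fst (snd i)"] exI[of _ "snd (snd i)"]) auto
  next
    assume "\<exists>i p q. i \<in> set (subproblems input) \<and> snd i = (p, q) \<and> s = (alg (fst i), p, q) \<and>
        m \<le> card (covered (set (alg (fst i))) (real p / real q))"
    then obtain i p q where i: "i \<in> set (subproblems input)" "snd i = (p, q)"
        "s = (alg (fst i), p, q)" "m \<le> card (covered (set (alg (fst i))) (real p / real q))"
      by blast
    then show "s \<in> set (candidates alg input)"
      using len[OF i(1,2)] by (auto simp: candidates_def Let_def intro!: image_eqI[of _ _ i])
  qed
qed

text \<open>Whether the fallback or a candidate is returned, the result is an output of
  \<open>alg\<close> on a valid PCM instance.\<close>

lemma best_candidate_relaxation:
  "enumerates (fst (best_candidate alg input)) (set (fst (best_candidate alg input)))"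
  "set (fst (best_candidate alg input)) \<in> relaxation K \<rho> F \<delta>"
proof -
  have mem: "fold (\<lambda>s acc. if P s acc then s else acc) xs z \<in> insert z (set xs)"
    for P xs and z :: "nat list \<times> nat \<times> nat"
  proof (induction xs arbitrary: z)
    case (Cons x xs)
    show ?case using Cons[of x] Cons[of z] by auto
  qed simp
  have "best_candidate alg input = (alg (fallback input), 1, 0) \<or>
      best_candidate alg input \<in> set (candidates alg input)"
    using mem unfolding best_candidate_def insert_iff .
  then have "\<exists>i P val. fst (best_candidate alg input) = alg i \<and> pcm_code K F \<delta> P val (enc i)"
  proof
    assume "best_candidate alg input = (alg (fallback input), 1, 0)"
    then show ?thesis using pcm_code_fallback by (metis fst_conv)
  next
    assume "best_candidate alg input \<in> set (candidates alg input)"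
    then obtain i z where "i \<in> set (subproblems input)" "best_candidate alg input = (alg (fst i), z)"
      unfolding set_candidates by blast
    then show ?thesis using pcm_code_subproblem[of i] by (metis fst_conv)
  qed
  then show "enumerates (fst (best_candidate alg input)) (set (fst (best_candidate alg input)))"
    "set (fst (best_candidate alg input)) \<in> relaxation K \<rho> F \<delta>"
    using alg_relaxation by metis+
qed

text \<open>At a radius that suffices for \<open>T\<close>, the perceptron bound excludes failure of
  all rounds; a round without lag has PCM optimum at least \<open>m\<close>.\<close>

lemma exists_candidate:
  assumes S: "S \<in> family K F \<delta>" and T: "T \<subseteq> C" "m \<le> card T"
    and uv: "u \<in> F \<union> C" "v \<in> F \<union> C" and cover: "\<And>w. w \<in> T \<Longrightarrow> \<exists>f\<in>S. d w f \<le> d u v"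
  shows "\<exists>s p q. (s, p, q) \<in> set (candidates alg input) \<and> 0 < q \<and> d u v = real p / real q"
proof -
  obtain p q where pq: "0 < q" "d u v = real p / real q"
    and sub: "\<And>t. t < card C ^ 3 + 1 \<Longrightarrow>
      (pcm_of fs \<delta> es (p, q) (loaded (load es (p, q) cs t) cs), p, q) \<in> set (subproblems input)"
    by (rule subproblemsI[OF uv]) (rule that)
  define L where "L = load es (p, q) cs"
  define h where "h t = head es (p, q) cs (L t)" for t
  define S' where "S' t = set (alg (pcm_of fs \<delta> es (p, q) (loaded (L t) cs)))" for t
  have "\<exists>t<card C ^ 3 + 1. card T \<le> card {w \<in> C. h t w \<in> T} \<or> m \<le> card (covered (S' t) (d u v))"
  proof (rule ccontr)
    assume neg: "\<not> ?thesis"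
    \<comment> \<open>If the claim fails, \<open>T\<close> lags in every round, which is one round
      more than \<open>perceptron_bound\<close> permits.\<close>
    have "card C ^ 3 + 1 \<le> card C ^ 3"
    proof (rule perceptron_bound[of C T L h])
      fix t
      show "w \<in> C \<Longrightarrow> h t w \<in> C" "w \<in> C \<Longrightarrow> L t (h t w) \<le> L t w" for w
        unfolding h_def using head_in[OF pq(1)] heads_subset[OF pq(1)] head_le[OF pq(1)] by blast+
      show "card {w \<in> C. h t w \<in> T} < card T" if "t < card C ^ 3 + 1"
        using neg that by force
    qed (use set_cs T in \<open>auto simp: L_def h_def\<close>)
    then show False by simp
  qed
  then obtain t where t: "t < card C ^ 3 + 1"
    "card T \<le> card {w \<in> C. h t w \<in> T} \<or> m \<le> card (covered (S' t) (d u v))" by blast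
  let ?i = "pcm_of fs \<delta> es (p, q) (loaded (L t) cs)"
  interpret clustering F C d "real p / real q" "heads es (p, q) cs (L t)" "h t"
    unfolding h_def by (rule clustering_heads[OF pq(1)])
  have "pcm_code K F \<delta> parts weight (enc ?i)"
    using pcm_code_pcm_of[OF pq(1) \<delta> down] unfolding h_def .
  from alg[OF this] have S't: "S' t \<in> relaxation K \<rho> F \<delta>"
      "\<forall>A\<in>parts. card (S' t \<inter> A) \<le> 1" "pcm_opt (family K F \<delta>) parts weight \<le> sum weight (S' t)"
    by (auto simp: S'_def enumerates_def)
  have "m \<le> card (covered (S' t) (d u v))"
    using t(2)
  proof
    assume "card T \<le> card {w \<in> C. h t w \<in> T}"
    also have "\<dots> \<le> pcm_opt (family K F \<delta>) parts weight"
      using cover by (intro covered_le_pcm_opt[OF down S]) (simp add: pq(2))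
    also have "\<dots> \<le> sum weight (S' t)" by (rule S't(3))
    also have "\<dots> \<le> card (covered (S' t) (d u v))"
      unfolding covered_def pq(2) using S't relax by (intro sum_weight_le_covered) auto
    finally show ?thesis using T(2) by simp
  qed
  then have "(alg ?i, p, q) \<in> set (candidates alg input)"
    unfolding set_candidates using sub[OF t(1)]
    by (intro exI[of _ "(?i, p, q)"] exI[of _ p] exI[of _ q]) (simp add: L_def S'_def pq(2))
  then show ?thesis using pq by blast
qed

text \<open>Some candidate has radius \<open>d u v\<close>, so the selected radius is no larger, and
  a larger radius covers at least as many customers.\<close>

lemma best_candidate_covered:
  assumes S: "S \<in> family K F \<delta>" and T: "T \<subseteq> C" "m \<le> card T"
    and uv: "u \<in> F \<union> C" "v \<in> F \<union> C" and cover: "\<And>w. w \<in> T \<Longrightarrow> \<exists>f\<in>S. d w f \<le> d u v"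
  shows "m \<le> card (covered (set (fst (best_candidate alg input))) (d u v))"
proof -
  let ?best = "best_candidate alg input"
  obtain s p q where s: "(s, p, q) \<in> set (candidates alg input)" "0 < q" "d u v = real p / real q"
    using exists_candidate[OF assms] by blast
  have den: "0 < snd (snd z)" if "z \<in> set (candidates alg input)" for z
    using that unfolding set_candidates by (auto elim: subproblemsE)
  have best: "?best \<in> set (candidates alg input)"
      "fst (snd ?best) * q \<le> p * snd (snd ?best)"
    using fold_best[of "\<lambda>s. fst (snd s)" "(alg (fallback input), 1, 0)" "\<lambda>s. snd (snd s)"
        "candidates alg input"] den s(1)
    unfolding best_candidate_def by fastforce+
  obtain i p' q' where i: "i \<in> set (subproblems input)" "snd i = (p', q')"
      "?best = (alg (fst i), p', q')" "m \<le> card (covered (set (alg (fst i))) (real p' / real q'))"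
    using best(1) unfolding set_candidates by blast
  have "0 < q'" using den[OF best(1)] i(3) by simp
  moreover have "real p' * real q \<le> real p * real q'"
    using best(2) i(3) unfolding of_nat_mult[symmetric] of_nat_le_iff by simp
  ultimately have le: "real p' / real q' \<le> d u v" unfolding s(3) using s(2) by (simp add: field_simps)
  have "covered (set (alg (fst i))) (real p' / real q') \<subseteq> covered (set (alg (fst i))) (d u v)"
  proof
    fix w assume "w \<in> covered (set (alg (fst i))) (real p' / real q')"
    then obtain f where f: "w \<in> C" "f \<in> set (alg (fst i))" "d w f \<le> 3 * (real p' / real q')"
      unfolding covered_def by blast
    have "d w f \<le> 3 * d u v" using f(3) le by linarith
    then show "w \<in> covered (set (alg (fst i))) (d u v)" using f(1,2) unfolding covered_def by blast
  qed
  then have "card (covered (set (alg (fst i))) (real p' / real q')) \<le> card (covered (set (alg (fst i))) (d u v))"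
    using set_cs(1) by (intro card_mono) (auto simp: covered_def)
  then show ?thesis using i(3,4) by simp
qed

lemma best_candidate_opt:
  assumes m: "m \<le> card C"
  defines "S \<equiv> set (fst (best_candidate alg input))"
  shows "m \<le> card {u \<in> C. dist_to d u S \<le> ennreal 3 * supplier_opt C d m (family K F \<delta>)}"
proof -
  let ?opt = "supplier_opt C d m (family K F \<delta>)"
  let ?I = "{(S, T). S \<in> family K F \<delta> \<and> T \<subseteq> C \<and> m \<le> card T}"
  have fin: "finite C" "finite F" using set_cs set_fs by auto
  show ?thesis
  proof (cases "?opt = top")
    \<comment> \<open>Three times infinity is infinity, so all customers satisfy the bound.\<close>
    case True
    then show ?thesis using m by (simp add: ennreal_mult_top)
  next
    case False
    \<comment> \<open>Finitely many pairs compete, and there is one because the infimum over no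
      pairs would be infinite; hence the optimum is attained.\<close>
    have "?I \<subseteq> Pow F \<times> Pow C" using down by (auto simp: down_closed_def)
    then have "finite ?I" using fin by (auto intro: finite_subset)
    moreover have "?I \<noteq> {}" using False by (auto simp: supplier_opt_def)
    ultimately have "?opt \<in> (\<lambda>(S, T). SUP u\<in>T. dist_to d u S) ` ?I"
      unfolding supplier_opt_def by (intro finite_Inf_in) (auto simp: inf_min min_def)
    then obtain S0 T where ST: "S0 \<in> family K F \<delta>" "T \<subseteq> C" "m \<le> card T"
      "?opt = (SUP u\<in>T. dist_to d u S0)" by auto
    have S0: "S0 \<subseteq> F" "finite S0" using ST(1) down fin by (auto simp: down_closed_def intro: finite_subset)
    show ?thesis
    proof (cases "T = {}")
      \<comment> \<open>Here \<open>m\<close> is \<open>0\<close>.\<close>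
      case True
      then show ?thesis using ST(3) by simp
    next
      case nonempty: False
      have fT: "finite T" using ST(2) fin finite_subset by blast
      \<comment> \<open>An empty \<open>S0\<close> would leave \<open>w\<close> at infinite
        distance, although the optimum is finite.\<close>
      have attained: "\<exists>f\<in>S0. dist_to d w S0 = ennreal (d w f)" if "w \<in> T" for w
      proof -
        have "dist_to d w S0 \<le> ?opt" unfolding ST(4) using that by (rule SUP_upper)
        then have "S0 \<noteq> {}" using False by (auto simp: dist_to_def top_unique)
        then have "dist_to d w S0 \<in> (\<lambda>f. ennreal (d w f)) ` S0"
          unfolding dist_to_def using S0(2) by (intro finite_Inf_in) (auto simp: inf_min min_def)
        then show ?thesis by auto
      qed
      have "?opt \<in> (\<lambda>w. dist_to d w S0) ` T"
        unfolding ST(4) using fT nonempty by (intro finite_Sup_in) (auto simp: sup_max max_def)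
      then obtain u where u: "u \<in> T" "?opt = dist_to d u S0" by auto
      \<comment> \<open>The optimum is thus a distance between two points of the instance and occurs
        among the radii tried.\<close>
      with attained[OF u(1)] obtain v where uv: "u \<in> T" "v \<in> S0" "?opt = ennreal (d u v)" by auto
      have "\<exists>f\<in>S0. d w f \<le> d u v" if w: "w \<in> T" for w
      proof -
        obtain f where f: "f \<in> S0" "dist_to d w S0 = ennreal (d w f)" using attained[OF w] by blast
        have "dist_to d w S0 \<le> ?opt" unfolding ST(4) using w by (rule SUP_upper)
        then show ?thesis using f uv(3) by (auto intro!: bexI[of _ f])
      qed
      then have "m \<le> card (covered S (d u v))"
        unfolding S_def using ST(2) S0(1) uv(1,2)
        by (intro best_candidate_covered[OF ST(1-3)]) auto
      also have "\<dots> \<le> card {u \<in> C. dist_to d u S \<le> ennreal 3 * ?opt}"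
      proof (rule card_mono)
        show "covered S (d u v) \<subseteq> {u \<in> C. dist_to d u S \<le> ennreal 3 * ?opt}"
        proof
          fix w assume "w \<in> covered S (d u v)"
          then obtain f where f: "w \<in> C" "f \<in> S" "d w f \<le> 3 * d u v" by (auto simp: covered_def)
          have "dist_to d w S \<le> ennreal (d w f)" unfolding dist_to_def using f(2) by (rule INF_lower)
          also have "\<dots> \<le> ennreal (3 * d u v)" using f(3) by (rule ennreal_leI)
          finally show "w \<in> {u \<in> C. dist_to d u S \<le> ennreal 3 * ?opt}"
            using f(1) by (simp add: uv(3) ennreal_mult)
        qed
      qed (use fin in simp)
      finally show ?thesis .
    qed
  qed
qed

end

end

section \<open>Transfer between data and typed values\<close>

lemma metric_code_entries:
  assumes "metric_code X d v"
  obtains es where "metric_entries X d es" "v = enc es"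
proof -
  obtain xs a b where xs: "enumerates xs X"
      "\<forall>x\<in>X. \<forall>y\<in>X. 0 < b x y \<and> d x y = real (a x y) / real (b x y)"
      "v = list_code [nats_code [x, y, a x y, b x y]. x \<leftarrow> xs, y \<leftarrow> xs]"
    using assms unfolding metric_code_def by blast
  let ?es = "[(x, y, a x y, b x y, 0). x \<leftarrow> xs, y \<leftarrow> xs] :: entry list"
  show thesis
  proof (rule that[of ?es])
    show "metric_entries X d ?es"
      unfolding metric_entries_def
      by (intro exI[of _ a] exI[of _ b] conjI xs(2)) (use xs(1) in \<open>auto simp: enumerates_def\<close>)
    show "v = enc ?es"
      by (simp add: xs(3) enc_list_def map_concat comp_def nats_code_def list_code_def enc_nat_def)
  qed
qed

lemma nats_code_enc: "nats_code xs = enc xs"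
  by (simp add: nats_code_def enc_list_def enc_nat_def[abs_def])

lemma supplier_code_input:
  assumes "supplier_code K F C d m \<delta> v"
  obtains fs cs es where "supplier_data F C d fs cs es" "v = enc (fs, cs, es, m, \<delta>, 0::nat)"
proof -
  obtain f c e where *: "set_code F f" "set_code C c" "metric_code (F \<union> C) d e"
      "v = list_code [f, c, e, Leaf m, \<delta>]" "Metric_space (F \<union> C) d"
    using assms by (auto simp: supplier_code_def supplier_instance_def)
  obtain fs cs where fc: "enumerates fs F" "f = enc fs" "enumerates cs C" "c = enc cs"
    using *(1,2) by (auto simp: set_code_def nats_code_enc)
  obtain es where "metric_entries (F \<union> C) d es" "e = enc es"
    using metric_code_entries[OF *(3)] .
  with * fc show thesis
    by (intro that[of fs cs es]) (auto simp: supplier_data_def list_code_def enc_nat_def enc_data_def)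
qed

lemma returns_unique: "returns c v w \<Longrightarrow> returns c v w' \<Longrightarrow> w = w'"
  unfolding returns_def runs_def using exec_deterministic by blast

text \<open>Turns a typed function back into a program. Every admissible datum must be a code, so
  that the time bound covers all of \<open>V\<close>.\<close>

lemma polynomial_time_enc:
  fixes f :: "'a::enc \<Rightarrow> 'b::enc"
  assumes "ptime {x. enc x \<in> V} f" and "\<And>v. v \<in> V \<Longrightarrow> \<exists>x::'a. v = enc x"
  obtains c where "polynomial_time c V" "\<And>x. enc x \<in> V \<Longrightarrow> returns c (enc x) (enc (f x))"
proof -
  obtain c p where c: "\<forall>x\<in>{x. enc x \<in> V}. \<exists>t. runs c (enc x) t (enc (f x)) \<and> t \<le> poly p (esize x)"
    using assms(1) unfolding ptime_def polyf_def by blast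
  show thesis
  proof (rule that[of c])
    show "polynomial_time c V"
      unfolding polynomial_time_def
    proof (intro exI[of _ p] ballI)
      fix v assume "v \<in> V"
      then obtain x :: 'a where "v = enc x" "enc x \<in> V" using assms(2) by blast
      then show "\<exists>t w. runs c v t w \<and> t \<le> poly p (dsize v)" using c by blast
    qed
    show "returns c (enc x) (enc (f x))" if "enc x \<in> V" for x :: 'a
      using c that unfolding returns_def by blast
  qed
qed

theorem theorem10:
  fixes K :: family_class and \<rho> :: real and A :: com
  assumes "valid_class K"
    and "\<rho> \<ge> 1"
    and "polynomial_time A (pcm_inputs K)"
    and "violating_pcm_algorithm K \<rho> A"
  shows "\<exists>B. polynomial_time B (supplier_inputs K) \<and>
             approx_violating_supplier_algorithm K 3 \<rho> B"
proof -
  \<comment> \<open>The program \<open>A\<close> becomes a function on typed inputs. On valid inputs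
    the choice is forced, because execution is deterministic and \<open>enc\<close> is
    injective.\<close>
  define alg :: "pcm_input \<Rightarrow> nat list" where "alg i = (SOME xs. returns A (enc i) (enc xs))" for i
  have alg_returns: "returns A (enc i) (enc (alg i)) \<and>
      (\<exists>S. enumerates (alg i) S \<and> S \<in> relaxation K \<rho> F \<delta> \<and> (\<forall>A\<in>P. card (S \<inter> A) \<le> 1) \<and>
        pcm_opt (family K F \<delta>) P val \<le> sum val S)"
    if code: "pcm_code K F \<delta> P val (enc i)" for F \<delta> P val i
  proof -
    obtain w S where w: "returns A (enc i) w" "set_code S w" "S \<in> relaxation K \<rho> F \<delta>"
        "\<forall>A\<in>P. card (S \<inter> A) \<le> 1" "pcm_opt (family K F \<delta>) P val \<le> sum val S"
      using assms(4) code unfolding violating_pcm_algorithm_def by blast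
    then obtain xs where xs: "enumerates xs S" "w = enc xs" by (auto simp: set_code_def nats_code_enc)
    have ret: "returns A (enc i) (enc (alg i))"
      unfolding alg_def by (rule someI[of _ xs]) (use w xs in simp)
    have "enc (alg i) = enc xs" using returns_unique[OF ret w(1)] xs(2) by simp
    then have "alg i = xs" by (rule enc_inject)
    then show ?thesis using ret w xs by blast
  qed
  have alg_spec: "\<exists>S. enumerates (alg i) S \<and> S \<in> relaxation K \<rho> F \<delta> \<and> (\<forall>A\<in>P. card (S \<inter> A) \<le> 1) \<and>
        pcm_opt (family K F \<delta>) P val \<le> sum val S"
    if "pcm_code K F \<delta> P val (enc i)" for F \<delta> P val i
    using alg_returns[OF that] by blast
  have alg: "ptime {i. enc i \<in> pcm_inputs K} alg"
  proof -
    obtain p where p: "\<forall>v\<in>pcm_inputs K. \<exists>t w. runs A v t w \<and> t \<le> poly p (dsize v)"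
      using assms(3) unfolding polynomial_time_def by blast
    have "\<exists>t. runs A (enc i) t (enc (alg i)) \<and> t \<le> poly p (esize i)"
      if i: "enc i \<in> pcm_inputs K" for i
    proof -
      obtain t w where t: "runs A (enc i) t w" "t \<le> poly p (esize i)" using p i by blast
      obtain F \<delta> P val where "pcm_code K F \<delta> P val (enc i)" using i unfolding pcm_inputs_def by blast
      then have "returns A (enc i) (enc (alg i))" using alg_returns by blast
      \<comment> \<open>By determinism the run with the time bound and the run with the
        approximation guarantee have the same output.\<close>
      then have "w = enc (alg i)" using t(1) returns_unique unfolding returns_def by blast
      then show ?thesis using t by blast
    qed
    then show ?thesis unfolding ptime_def polyf_def by blast
  qed
  have valid: "down_closed F (family K F \<delta>)" "relaxation K \<rho> F \<delta> \<subseteq> Pow F"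
    if "\<delta> \<in> descriptions K F" "finite F" for F \<delta>
    using assms(1,2) that unfolding valid_class_def by auto
  have best_ptime: "ptime {x. enc x \<in> supplier_inputs K} (\<lambda>x. fst (best_candidate alg x))"
  proof (rule ptime_best_candidate[OF alg])
    fix x :: supplier_input assume "x \<in> {x. enc x \<in> supplier_inputs K}"
    then obtain F C d m \<delta> where code: "supplier_code K F C d m \<delta> (enc x)"
      by (auto simp: supplier_inputs_def)
    obtain fs cs es where inst: "supplier_data F C d fs cs es" "enc x = enc (fs, cs, es, m, \<delta>, 0::nat)"
      using supplier_code_input[OF code] .
    have x: "x = (fs, cs, es, m, \<delta>, 0)" by (rule enc_inject[OF inst(2)])
    have \<delta>: "\<delta> \<in> descriptions K F" "finite F"
      using code by (auto simp: supplier_code_def supplier_instance_def)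
    have "pcm_code K F \<delta> {} (\<lambda>_. 0) (enc (fallback x))"
      unfolding x
      by (rule supplier_data.pcm_code_fallback[OF inst(1) \<delta>(1) valid[OF \<delta>]]) (rule alg_spec)
    then show "fallback x \<in> {i. enc i \<in> pcm_inputs K}" unfolding pcm_inputs_def by blast
    fix i assume i: "i \<in> set (subproblems x)"
    have "\<exists>P val. pcm_code K F \<delta> P val (enc (fst i))"
      by (rule supplier_data.pcm_code_subproblem[OF inst(1) \<delta>(1) valid[OF \<delta>] _ i[unfolded x]])
        (rule alg_spec)
    then show "fst i \<in> {i. enc i \<in> pcm_inputs K}" unfolding pcm_inputs_def by blast
  qed
  have encoded: "\<exists>x :: supplier_input. v = enc x" if v: "v \<in> supplier_inputs K" for v
  proof -
    obtain F C d m \<delta> where "supplier_code K F C d m \<delta> v"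
      using v unfolding supplier_inputs_def by blast
    from supplier_code_input[OF this] show ?thesis by metis
  qed
  obtain B where B: "polynomial_time B (supplier_inputs K)"
    "\<And>x. enc x \<in> supplier_inputs K \<Longrightarrow> returns B (enc x) (enc (fst (best_candidate alg x)))"
    using polynomial_time_enc[OF best_ptime encoded] by blast
  have "approx_violating_supplier_algorithm K 3 \<rho> B"
    unfolding approx_violating_supplier_algorithm_def
  proof (intro allI impI)
    fix F C d m \<delta> v
    assume code: "supplier_code K F C d m \<delta> v"
    obtain fs cs es where inst: "supplier_data F C d fs cs es" "v = enc (fs, cs, es, m, \<delta>, 0::nat)"
      using supplier_code_input[OF code] .
    have \<delta>: "\<delta> \<in> descriptions K F" "finite F" and m: "m \<le> card C"
      using code by (auto simp: supplier_code_def supplier_instance_def)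
    let ?xs = "fst (best_candidate alg (fs, cs, es, m, \<delta>, 0))"
    have "v \<in> supplier_inputs K" using code unfolding supplier_inputs_def by blast
    then have "returns B v (enc ?xs)" unfolding inst(2) by (rule B(2))
    moreover have "enumerates ?xs (set ?xs)"
      by (rule supplier_data.best_candidate_relaxation(1)[OF inst(1) \<delta>(1) valid[OF \<delta>]]) (rule alg_spec)
    then have "set_code (set ?xs) (enc ?xs)" unfolding set_code_def nats_code_enc by blast
    moreover have "set ?xs \<in> relaxation K \<rho> F \<delta>"
      by (rule supplier_data.best_candidate_relaxation(2)[OF inst(1) \<delta>(1) valid[OF \<delta>]]) (rule alg_spec)
    moreover have "m \<le> card {u \<in> C. dist_to d u (set ?xs) \<le> ennreal 3 * supplier_opt C d m (family K F \<delta>)}"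
      by (rule supplier_data.best_candidate_opt[OF inst(1) \<delta>(1) valid[OF \<delta>] _ m]) (rule alg_spec)
    ultimately show "\<exists>w S. returns B v w \<and> set_code S w \<and> S \<in> relaxation K \<rho> F \<delta> \<and>
        m \<le> card {u \<in> C. dist_to d u S \<le> ennreal 3 * supplier_opt C d m (family K F \<delta>)}"
      by blast
  qed
  then show ?thesis using B(1) by blast
qed

end
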